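(* Let $z\in\{\pm1\}^n$ and $Y=zz^\top+\gamma W$, where $\gamma\ge0$ is the noise level and $W\in\mathbf{S}^n$ is a random symmetric matrix with i.i.d. standard normal entries above the diagonal and zero diagonal. If $\gamma<\sqrt{\frac{n}{(2+\epsilon)\log n}}$ for some numerical constant $\epsilon>0$, then with high probability the SDP $$\text{minimize }\operatorname{tr}(-YX)\quad\text{subject to}\quad\operatorname{diag}(X)=1,\ X\succeq0,\qquad X\in\mathbf{S}^n,$$ is simple with primal solution $zz^\top$. Moreover, the dual solution $y_\star$, with slack matrix $Z_\star=-Y-\operatorname{Diag}(y_\star)$, satisfies $\lambda_{n-1}(Z_\star)>cn$ for some numerical constant $c\in(0,1)$.
   Context: $\mathbf{S}^n$ is the space of real symmetric $n\times n$ matrices with the trace inner product $\langle X,Y\rangle=\operatorname{tr}(X^\top Y)$. Eigenvalues are written in decreasing order $\lambda_1(A)\ge\cdots\ge\lambda_n(A)$, so $\lambda_{n-1}$ is the second smallest. $\operatorname{diag}(X)=1$ means all diagonal entries of $X$ equal $1$; $\operatorname{Diag}(y)$ is the diagonal matrix with diagonal $y$. "With high probability" means with probability tending to $1$ as $n\to\infty$; $\epsilon$ is a fixed constant, and $c$ is a constant not depending on $n$, $z$ or $\gamma$ (it may depend on the constant $\epsilon$). Consider a standard form SDP (P): minimize $\langle C,X\rangle$ subject to $\mathcal{A}X=b$, $X\succeq0$, with variable $X\in\mathbf{S}^n$, where $[\mathcal{A}X]_i=\langle A_i,X\rangle$ for $i=1,\dots,m$ with fixed $A_i\in\mathbf{S}^n$.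 Its dual (D) is: maximize $\langle b,y\rangle$ subject to $C-\mathcal{A}^*y\succeq0$, with variable $y\in\mathbb{R}^m$, where $\mathcal{A}^*y=\sum_i y_iA_i$; the slack matrix of $y$ is $C-\mathcal{A}^*y$. "Solution" means optimal solution. (For the SDP in the claim, $C=-Y$, $\mathcal{A}=\operatorname{diag}$, $\mathcal{A}^*=\operatorname{Diag}$, $b$ is the all-ones vector.) - Strong duality: a primal-dual solution pair exists, and for any solution pair $(X_\star,y_\star)$ of (P) and (D), $\operatorname{tr}(CX_\star)=b^\top y_\star$. - Surjective constraint map: $\mathcal{A}:\mathbf{S}^n\to\mathbb{R}^m$ is surjective, equivalently the matrices $A_i$ are linearly independent. - Strict complementarity: there is a solution pair $(X_\star,y_\star)$ of (P) and (D) with $\operatorname{rank}(X_\star)+\operatorname{rank}(C-\mathcal{A}^*y_\star)=n$. - (P) is simple if it satisfies strong duality, has a surjective constraint map, satisfies strict complementarity, and both (P) and (D) have unique solutions. *)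

theory Defs
  imports "HOL-Probability.Probability" "Jordan_Normal_Form.DL_Rank" "Jordan_Normal_Form.Char_Poly"
begin

unbundle no vec_syntax
no_notation inner (infix "\<bullet>" 70)
hide_type (open) Finite_Cartesian_Product.vec
hide_const (open) Finite_Cartesian_Product.vec Finite_Cartesian_Product.mat

definition sym_mats :: "nat \<Rightarrow> real mat set" where
  "sym_mats n = {A \<in> carrier_mat n n. transpose_mat A = A}"

definition psd :: "nat \<Rightarrow> real mat \<Rightarrow> bool" where
  "psd n A \<longleftrightarrow> A \<in> sym_mats n \<and> (\<forall>v \<in> carrier_vec n. 0 \<le> v \<bullet> (A *\<^sub>v v))"

definition mat_trace :: "real mat \<Rightarrow> real" where
  "mat_trace A = (\<Sum>i<dim_row A. A $$ (i, i))"

definition mat_inner :: "real mat \<Rightarrow> real mat \<Rightarrow> real" where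
  "mat_inner A B = mat_trace (transpose_mat A * B)"

definition mat_rank :: "real mat \<Rightarrow> nat" where
  "mat_rank A = vec_space.rank (dim_row A) A"

definition Diag :: "real vec \<Rightarrow> real mat" where
  "Diag y = mat_diag (dim_vec y) (\<lambda>i. y $ i)"

definition outer :: "real vec \<Rightarrow> real mat" where
  "outer z = mat (dim_vec z) (dim_vec z) (\<lambda>(i, j). z $ i * z $ j)"

text \<open>\<open>eig k A\<close> is the \<open>k\<close>-th largest eigenvalue, counted from \<open>k = 1\<close> and with multiplicity.
  It is meaningful for symmetric \<open>A\<close> of size \<open>n\<close> and \<open>1 \<le> k \<le> n\<close>, since then the
  characteristic polynomial has \<open>n\<close> real roots.\<close>

definition eig :: "nat \<Rightarrow> real mat \<Rightarrow> real" where
  "eig k A = rev (sorted_list_of_multiset (proots (char_poly A))) ! (k - 1)"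

text \<open>Constraint matrices are indexed from \<open>0\<close>; only those with index below \<open>sdp_m\<close> matter.\<close>

record sdp =
  sdp_n :: nat
  sdp_m :: nat
  sdp_C :: "real mat"
  sdp_A :: "nat \<Rightarrow> real mat"
  sdp_b :: "real vec"

definition standard_form :: "sdp \<Rightarrow> bool" where
  "standard_form P \<longleftrightarrow>
     sdp_C P \<in> sym_mats (sdp_n P) \<and> (\<forall>i<sdp_m P. sdp_A P i \<in> sym_mats (sdp_n P)) \<and>
     sdp_b P \<in> carrier_vec (sdp_m P)"

definition constraint_map :: "sdp \<Rightarrow> real mat \<Rightarrow> real vec" where
  "constraint_map P X = vec (sdp_m P) (\<lambda>i. mat_inner (sdp_A P i) X)"

definition constraint_adjoint :: "sdp \<Rightarrow> real vec \<Rightarrow> real mat" where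
  "constraint_adjoint P y =
     mat (sdp_n P) (sdp_n P) (\<lambda>(r, s). \<Sum>i<sdp_m P. y $ i * sdp_A P i $$ (r, s))"

definition slack :: "sdp \<Rightarrow> real vec \<Rightarrow> real mat" where
  "slack P y = sdp_C P - constraint_adjoint P y"

definition primal_feasible :: "sdp \<Rightarrow> real mat \<Rightarrow> bool" where
  "primal_feasible P X \<longleftrightarrow> psd (sdp_n P) X \<and> constraint_map P X = sdp_b P"

definition dual_feasible :: "sdp \<Rightarrow> real vec \<Rightarrow> bool" where
  "dual_feasible P y \<longleftrightarrow> y \<in> carrier_vec (sdp_m P) \<and> psd (sdp_n P) (slack P y)"

definition primal_solution :: "sdp \<Rightarrow> real mat \<Rightarrow> bool" where
  "primal_solution P X \<longleftrightarrow> primal_feasible P X \<and>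
     (\<forall>X'. primal_feasible P X' \<longrightarrow> mat_inner (sdp_C P) X \<le> mat_inner (sdp_C P) X')"

definition dual_solution :: "sdp \<Rightarrow> real vec \<Rightarrow> bool" where
  "dual_solution P y \<longleftrightarrow> dual_feasible P y \<and>
     (\<forall>y'. dual_feasible P y' \<longrightarrow> sdp_b P \<bullet> y' \<le> sdp_b P \<bullet> y)"

definition strong_duality :: "sdp \<Rightarrow> bool" where
  "strong_duality P \<longleftrightarrow>
     (\<exists>X y. primal_solution P X \<and> dual_solution P y) \<and>
     (\<forall>X y. primal_solution P X \<and> dual_solution P y \<longrightarrow> mat_trace (sdp_C P * X) = sdp_b P \<bullet> y)"

definition surjective_constraint_map :: "sdp \<Rightarrow> bool" where
  "surjective_constraint_map P \<longleftrightarrow>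
     constraint_map P ` sym_mats (sdp_n P) = carrier_vec (sdp_m P)"

definition strict_complementarity :: "sdp \<Rightarrow> bool" where
  "strict_complementarity P \<longleftrightarrow>
     (\<exists>X y. primal_solution P X \<and> dual_solution P y \<and>
        mat_rank X + mat_rank (slack P y) = sdp_n P)"

definition simple_sdp :: "sdp \<Rightarrow> bool" where
  "simple_sdp P \<longleftrightarrow>
     strong_duality P \<and> surjective_constraint_map P \<and> strict_complementarity P \<and>
     (\<exists>!X. primal_solution P X) \<and> (\<exists>!y. dual_solution P y)"

text \<open>The constraint matrices are the diagonal matrix units, so that the constraint map is
  \<open>X \<mapsto> diag X\<close> and its adjoint is \<^const>\<open>Diag\<close>; the lemmas below confirm this.\<close>

definition diag_unit :: "nat \<Rightarrow> nat \<Rightarrow> real mat" where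
  "diag_unit n i = mat n n (\<lambda>(r, s). if r = i \<and> s = i then 1 else 0)"

definition diag_sdp :: "real mat \<Rightarrow> sdp" where
  "diag_sdp Y = \<lparr>sdp_n = dim_row Y, sdp_m = dim_row Y, sdp_C = - Y,
     sdp_A = diag_unit (dim_row Y), sdp_b = vec (dim_row Y) (\<lambda>_. 1)\<rparr>"

lemma mat_inner_diag_unit:
  assumes "X \<in> carrier_mat n n" "i < n"
  shows "mat_inner (diag_unit n i) X = X $$ (i, i)"
proof -
  have "mat_inner (diag_unit n i) X =
      (\<Sum>r<n. \<Sum>s<n. (if s = i \<and> r = i then 1 else 0) * X $$ (s, r))"
    using assms by (auto simp: mat_inner_def mat_trace_def diag_unit_def scalar_prod_def
        lessThan_atLeast0 intro!: sum.cong)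
  also have "\<dots> = (\<Sum>r<n. \<Sum>s<n. if s = i then if r = i then X $$ (i, i) else 0 else 0)"
    by (intro sum.cong) auto
  also have "\<dots> = X $$ (i, i)"
    using assms by simp
  finally show ?thesis .
qed

lemma constraint_map_diag_sdp:
  assumes "Y \<in> carrier_mat n n" "X \<in> carrier_mat n n"
  shows "constraint_map (diag_sdp Y) X = vec n (\<lambda>i. X $$ (i, i))"
  using assms by (auto simp: constraint_map_def diag_sdp_def mat_inner_diag_unit)

lemma constraint_adjoint_diag_sdp:
  assumes "Y \<in> carrier_mat n n" "y \<in> carrier_vec n"
  shows "constraint_adjoint (diag_sdp Y) y = Diag y"
proof (rule eq_matI)
  fix r s assume "r < dim_row (Diag y)" "s < dim_col (Diag y)"
  then have rs: "r < n" "s < n"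
    using assms by (auto simp: Diag_def mat_diag_def)
  have "(\<Sum>i<n. y $ i * diag_unit n i $$ (r, s)) = (\<Sum>i<n. if i = r then if s = r then y $ r else 0 else 0)"
    using rs by (intro sum.cong) (auto simp: diag_unit_def)
  then show "constraint_adjoint (diag_sdp Y) y $$ (r, s) = Diag y $$ (r, s)"
    using rs assms by (simp add: constraint_adjoint_def diag_sdp_def Diag_def mat_diag_def)
qed (use assms in \<open>auto simp: constraint_adjoint_def diag_sdp_def Diag_def mat_diag_def\<close>)

lemma slack_diag_sdp:
  assumes "Y \<in> carrier_mat n n" "y \<in> carrier_vec n"
  shows "slack (diag_sdp Y) y = - Y - Diag y"
  using constraint_adjoint_diag_sdp[OF assms] by (simp add: slack_def diag_sdp_def)

lemma standard_form_diag_sdp: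
  assumes "Y \<in> sym_mats n"
  shows "standard_form (diag_sdp Y)"
proof -
  have Y: "Y \<in> carrier_mat n n" "transpose_mat Y = Y"
    using assms by (auto simp: sym_mats_def)
  have "transpose_mat (- Y) = - Y"
    using Y by (simp add: transpose_uminus)
  then show ?thesis
    using Y by (auto simp: standard_form_def diag_sdp_def sym_mats_def diag_unit_def)
qed

definition sign_vecs :: "nat \<Rightarrow> real vec set" where
  "sign_vecs n = {z \<in> carrier_vec n. \<forall>i<n. z $ i = 1 \<or> z $ i = - 1}"

definition gaussian_noise :: "nat \<Rightarrow> 'a measure \<Rightarrow> ('a \<Rightarrow> real mat) \<Rightarrow> bool" where
  "gaussian_noise n M W \<longleftrightarrow>
     prob_space M \<and>
     (\<forall>\<omega> \<in> space M. W \<omega> \<in> sym_mats n \<and> (\<forall>i<n. W \<omega> $$ (i, i) = 0)) \<and>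
     prob_space.indep_vars M (\<lambda>_. borel) (\<lambda>p \<omega>. W \<omega> $$ p) {(i, j). i < j \<and> j < n} \<and>
     (\<forall>i j. i < j \<and> j < n \<longrightarrow>
        distributed M lborel (\<lambda>\<omega>. W \<omega> $$ (i, j)) std_normal_density)"

text \<open>The property \<open>Q n\<close> holds with probability tending to \<open>1\<close>. Measurable subevents are used
  because \<^const>\<open>measure\<close> is \<open>0\<close> on non-measurable sets; for measurable \<open>Q n\<close> this says that the
  probability of \<open>Q n\<close> itself tends to \<open>1\<close>.\<close>

definition whp :: "(nat \<Rightarrow> 'a measure) \<Rightarrow> (nat \<Rightarrow> 'a \<Rightarrow> bool) \<Rightarrow> bool" where
  "whp M Q \<longleftrightarrow>
     (\<exists>E. (\<forall>n. E n \<in> sets (M n) \<and> (\<forall>\<omega> \<in> E n. Q n \<omega>)) \<and>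
          (\<lambda>n. measure (M n) (E n)) \<longlonglongrightarrow> 1)"

end

theory Submission
  imports Defs "Jordan_Normal_Form.Schur_Decomposition" "HOL-Real_Asymp.Real_Asymp"
begin

text \<open>
  The proof exhibits the dual solution. Complementary slackness with \<open>z z\<^sup>T\<close> demands that the slack
  matrix \<open>Z = - Y - Diag y\<close> annihilate \<open>z\<close>, which determines \<open>y\<close> uniquely:
  \<open>y\<^sub>i = - z\<^sub>i (Y z)\<^sub>i = - (n + \<gamma> z\<^sub>i (W z)\<^sub>i)\<close>. For \<open>v\<close> orthogonal to \<open>z\<close> one then has
  \<open>v \<bullet> Z v = (\<Sum>i. (n + \<gamma> z\<^sub>i (W z)\<^sub>i) v\<^sub>i\<^sup>2) - \<gamma> (v \<bullet> W v)\<close>, so everything follows from a lower bound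
  \<open>v \<bullet> Z v \<ge> \<kappa> (v \<bullet> v)\<close> on that hyperplane with \<open>\<kappa> > c n\<close>.

  Given such a bound (\<open>diag_sdp_simple_of_coercive\<close>), \<open>Z\<close> is positive semidefinite with kernel spanned
  by \<open>z\<close>. Writing a feasible \<open>X\<close> in Gram form gives \<open>\<langle>Z, X\<rangle> \<ge> 0\<close>, with equality only for
  \<open>X = z z\<^sup>T\<close>; together with the uniqueness of \<open>y\<close> this yields optimality, uniqueness and strict
  complementarity. The characteristic polynomial of \<open>Z\<close> splits over the reals, and \<open>0\<close> is a simple
  root of it while all other roots are at least \<open>\<kappa>\<close> (\<open>coercive_eig\<close>).

  The bound itself holds with high probability (\<open>gaussian_noise_bounds\<close>). Each \<open>z\<^sub>i (W z)\<^sub>i\<close> is normal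
  with variance \<open>n - 1\<close>, so by a union bound all of them exceed \<open>- sqrt ((2 + \<epsilon> / 2) n ln n)\<close> except on
  an event of probability at most \<open>n powr (- \<epsilon> / 4)\<close>; multiplied by \<open>\<gamma>\<close>, this is at most a fixed fraction
  below \<open>1\<close> of \<open>n\<close>. For the second term, \<open>v \<bullet> W v \<le> 32 sqrt n (v \<bullet> v)\<close> outside an event of probability
  at most \<open>(1 / 2) ^ n\<close>: as \<open>W\<close> has zero diagonal, the form is affine in each coordinate, so its
  maximum over a ball is controlled by its values at at most \<open>48 ^ n\<close> integer points
  (\<open>quadratic_form_le_of_lattice_points\<close>), at each of which a Chernoff bound applies. After
  multiplication by \<open>\<gamma>\<close> this term is \<open>o(n)\<close>.
\<close>

section \<open>Quadratic forms and Gram decompositions\<close>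

lemma scalar_prod_mult_mat_vec_sum:
  fixes A :: "real mat"
  assumes "A \<in> carrier_mat n n" "v \<in> carrier_vec n" "w \<in> carrier_vec n"
  shows "v \<bullet> (A *\<^sub>v w) = (\<Sum>i<n. \<Sum>j<n. A $$ (i, j) * v $ i * w $ j)"
  using assms
  by (auto simp: scalar_prod_def row_def sum_distrib_left lessThan_atLeast0 mult_ac intro!: sum.cong)

lemma sym_mats_entry:
  assumes "A \<in> sym_mats n" "i < n" "j < n"
  shows "A $$ (i, j) = A $$ (j, i)"
proof -
  have "A \<in> carrier_mat n n" "transpose_mat A = A" using assms(1) by (auto simp: sym_mats_def)
  then show ?thesis using assms(2,3) by (metis carrier_matD index_transpose_mat(1))
qed

lemma sym_mats_scalar_prod_commute:
  assumes "A \<in> sym_mats n" "v \<in> carrier_vec n" "w \<in> carrier_vec n"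
  shows "v \<bullet> (A *\<^sub>v w) = w \<bullet> (A *\<^sub>v v)"
proof -
  have A: "A \<in> carrier_mat n n" using assms(1) by (simp add: sym_mats_def)
  note s = sym_mats_entry[OF assms(1)]
  have "v \<bullet> (A *\<^sub>v w) = (\<Sum>j<n. \<Sum>i<n. A $$ (i, j) * v $ i * w $ j)"
    unfolding scalar_prod_mult_mat_vec_sum[OF A assms(2,3)] by (rule sum.swap)
  also have "\<dots> = (\<Sum>j<n. \<Sum>i<n. A $$ (j, i) * w $ j * v $ i)"
    by (intro sum.cong refl) (simp add: s mult_ac)
  also have "\<dots> = w \<bullet> (A *\<^sub>v v)"
    by (rule scalar_prod_mult_mat_vec_sum[OF A assms(3,2), symmetric])
  finally show ?thesis .
qed

lemma scalar_prod_self_nonneg: "0 \<le> (v :: real vec) \<bullet> v"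
  by (auto simp: scalar_prod_def intro!: sum_nonneg)

lemma scalar_prod_self_eq_0:
  fixes v :: "real vec"
  assumes "v \<in> carrier_vec n" "v \<bullet> v = 0"
  shows "v = 0\<^sub>v n"
proof (rule eq_vecI)
  fix i assume i: "i < dim_vec (0\<^sub>v n)"
  have "(\<Sum>i\<in>{0..<n}. v $ i * v $ i) = 0"
    using assms by (auto simp: scalar_prod_def)
  then have "\<forall>i\<in>{0..<n}. v $ i * v $ i = 0"
    by (subst (asm) sum_nonneg_eq_0_iff) auto
  with i show "v $ i = 0\<^sub>v n $ i" by auto
qed (use assms in auto)

lemma quadratic_form_combination:
  assumes A: "A \<in> sym_mats n" and v: "v \<in> carrier_vec n" "w \<in> carrier_vec n"
  shows "(v + t \<cdot>\<^sub>v w) \<bullet> (A *\<^sub>v (v + t \<cdot>\<^sub>v w)) =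
    v \<bullet> (A *\<^sub>v v) + 2 * t * (w \<bullet> (A *\<^sub>v v)) + t\<^sup>2 * (w \<bullet> (A *\<^sub>v w))"
proof -
  have A': "A \<in> carrier_mat n n" using A by (auto simp: sym_mats_def)
  have c: "A *\<^sub>v v \<in> carrier_vec n" "A *\<^sub>v w \<in> carrier_vec n"
    using A' v by auto
  have "(v + t \<cdot>\<^sub>v w) \<bullet> (A *\<^sub>v (v + t \<cdot>\<^sub>v w)) = (v + t \<cdot>\<^sub>v w) \<bullet> (A *\<^sub>v v + t \<cdot>\<^sub>v (A *\<^sub>v w))"
    using A' v by (simp add: mult_add_distrib_mat_vec mult_mat_vec)
  also have "\<dots> = v \<bullet> (A *\<^sub>v v) + t * (v \<bullet> (A *\<^sub>v w)) + t * (w \<bullet> (A *\<^sub>v v)) + t * t * (w \<bullet> (A *\<^sub>v w))"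
    using v c by (simp add: add_scalar_prod_distrib[of _ n] scalar_prod_add_distrib[of _ n] algebra_simps)
  also have "v \<bullet> (A *\<^sub>v w) = w \<bullet> (A *\<^sub>v v)"
    by (rule sym_mats_scalar_prod_commute[OF A v])
  finally show ?thesis by (simp add: power2_eq_square)
qed

lemma psd_quadratic_form_eq_0:
  assumes A: "psd n A" and v: "v \<in> carrier_vec n" and 0: "v \<bullet> (A *\<^sub>v v) = 0"
  shows "A *\<^sub>v v = 0\<^sub>v n"
proof (rule ccontr)
  assume ne: "A *\<^sub>v v \<noteq> 0\<^sub>v n"
  have S: "A \<in> sym_mats n" and A': "A \<in> carrier_mat n n"
    using A by (auto simp: psd_def sym_mats_def)
  define w where "w = A *\<^sub>v v"
  have w: "w \<in> carrier_vec n" using A' v by (auto simp: w_def)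
  define s where "s = w \<bullet> w"
  define q where "q = w \<bullet> (A *\<^sub>v w)"
  have q: "0 \<le> q" using A w by (auto simp: psd_def q_def)
  have s: "s > 0"
    using scalar_prod_self_nonneg[of w] scalar_prod_self_eq_0[OF w] ne
    unfolding s_def w_def by (metis order_le_less)
  \<comment> \<open>Moving from \<open>v\<close> by a suitable step along \<open>- A v\<close> would make the form negative.\<close>
  define u where "u = s / (q + 1)"
  have su: "s = u * (q + 1)" using q by (simp add: u_def)
  have "0 \<le> (v + (- u) \<cdot>\<^sub>v w) \<bullet> (A *\<^sub>v (v + (- u) \<cdot>\<^sub>v w))"
    using A v w by (auto simp: psd_def)
  also have "\<dots> = 2 * (- u) * s + (- u)\<^sup>2 * q"
    unfolding quadratic_form_combination[OF S v w] 0 by (simp add: s_def q_def w_def)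
  also have "\<dots> = u\<^sup>2 * (- q - 2)"
    unfolding su by (simp add: algebra_simps power2_eq_square)
  also have "\<dots> < 0"
    using s q by (intro mult_pos_neg) (auto simp: u_def)
  finally show False by simp
qed

text \<open>Existence of a Gram decomposition, by eliminating the last coordinate as in the Cholesky
  algorithm: if the last diagonal entry \<open>d\<close> vanishes, so does its whole row; otherwise the Schur
  complement is again positive semidefinite. Division by zero makes the vector \<open>h\<close> below vanish in
  the degenerate case, so that both cases are handled together.\<close>

lemma psd_gram:
  fixes f :: "nat \<Rightarrow> nat \<Rightarrow> real"
  assumes "\<And>i j. i < n \<Longrightarrow> j < n \<Longrightarrow> f i j = f j i"
    and "\<And>v :: nat \<Rightarrow> real. 0 \<le> (\<Sum>i<n. \<Sum>j<n. f i j * v i * v j)"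
  shows "\<exists>(m::nat) g. \<forall>i<n. \<forall>j<n. f i j = (\<Sum>k<m. g k i * g k j)"
  using assms
proof (induction n arbitrary: f)
  case 0
  then show ?case by auto
next
  case (Suc n)
  note sym = Suc.prems(1) and pos = Suc.prems(2)
  have expand: "(\<Sum>i<Suc n. \<Sum>j<Suc n. f i j * v i * v j) =
      (\<Sum>i<n. \<Sum>j<n. f i j * v i * v j) + 2 * v n * (\<Sum>i<n. f i n * v i) + f n n * (v n)\<^sup>2"
    for v :: "nat \<Rightarrow> real"
  proof -
    have "(\<Sum>j<n. f n j * v n * v j) = v n * (\<Sum>i<n. f i n * v i)"
      by (auto simp: sum_distrib_left sym mult_ac intro!: sum.cong)
    moreover have "(\<Sum>i<n. f i n * v i * v n) = v n * (\<Sum>i<n. f i n * v i)"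
      by (auto simp: sum_distrib_left mult_ac intro!: sum.cong)
    ultimately show ?thesis
      by (simp add: sum.distrib power2_eq_square)
  qed
  define d where "d = f n n"
  have d: "d \<ge> 0"
    using pos[of "\<lambda>i. if i = n then 1 else 0"] unfolding expand d_def by simp
  have zero: "f i n = 0" if "d = 0" "i < n" for i
  proof -
    have "0 \<le> f i i + 2 * t * f i n" for t
    proof -
      have "(\<Sum>a<n. \<Sum>b<n. f a b * (if a = i then 1 else 0) * (if b = i then 1 else 0)) =
          (\<Sum>a<n. \<Sum>b<n. if b = i then if a = i then f i i else 0 else 0)"
        by (intro sum.cong) auto
      also have "\<dots> = f i i" using that by simp
      finally have 1: "(\<Sum>a<n. \<Sum>b<n. f a b * (if a = i then 1 else 0) * (if b = i then 1 else 0)) = f i i" .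
      have 2: "(\<Sum>a<n. f a n * (if a = i then 1 else 0)) = f i n"
        using that by (simp add: if_distrib cong: if_cong)
      define v where "v = (\<lambda>a. if a = n then t else if a = i then 1 else 0)"
      have "0 \<le> (\<Sum>a<n. \<Sum>b<n. f a b * v a * v b) + 2 * v n * (\<Sum>a<n. f a n * v a) + f n n * (v n)\<^sup>2"
        using pos[of v] unfolding expand .
      also have "(\<Sum>a<n. \<Sum>b<n. f a b * v a * v b) = f i i"
        unfolding 1[symmetric] by (intro sum.cong) (auto simp: v_def)
      also have "(\<Sum>a<n. f a n * v a) = f i n"
        unfolding 2[symmetric] by (intro sum.cong) (auto simp: v_def)
      finally show ?thesis using that by (simp add: v_def d_def)
    qed
    \<comment> \<open>An affine function of \<open>t\<close> bounded below has slope zero.\<close>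
    from this[of "- (f i i + 1) / (2 * f i n)"] show ?thesis
      by (cases "f i n = 0") (auto simp: field_simps)
  qed
  define h where "h i = f i n / sqrt d" for i
  have h: "h i * h j = f i n * f j n / d" for i j
    using d by (simp add: h_def)
  have hn: "h i * h n = f i n" if "i \<le> n" for i
    using zero[of i] that d_def unfolding h by (cases "i = n") (auto)
  define f' where "f' i j = f i j - h i * h j" for i j
  have "\<exists>(m::nat) g. \<forall>i<n. \<forall>j<n. f' i j = (\<Sum>k<m. g k i * g k j)"
  proof (rule Suc.IH)
    show "f' i j = f' j i" if "i < n" "j < n" for i j
      using sym[of i j] that by (simp add: f'_def)
    fix v :: "nat \<Rightarrow> real"
    define s where "s = (\<Sum>i<n. f i n * v i)"
    have hh: "(\<Sum>i<n. \<Sum>j<n. h i * h j * v i * v j) = s\<^sup>2 / d"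
      unfolding h s_def power2_eq_square sum_product sum_divide_distrib
      by (intro sum.cong) (auto simp: mult_ac)
    \<comment> \<open>The minimiser of the form over the last coordinate.\<close>
    define v' where "v' = v(n := - s / d)"
    have "0 \<le> (\<Sum>a<n. \<Sum>b<n. f a b * v' a * v' b) + 2 * v' n * (\<Sum>a<n. f a n * v' a) + f n n * (v' n)\<^sup>2"
      using pos[of v'] unfolding expand .
    also have "(\<Sum>a<n. \<Sum>b<n. f a b * v' a * v' b) = (\<Sum>a<n. \<Sum>b<n. f a b * v a * v b)"
      by (intro sum.cong) (auto simp: v'_def)
    also have "(\<Sum>a<n. f a n * v' a) = s"
      unfolding s_def by (intro sum.cong) (auto simp: v'_def)
    also have "(\<Sum>a<n. \<Sum>b<n. f a b * v a * v b) + 2 * v' n * s + f n n * (v' n)\<^sup>2 =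
       (\<Sum>a<n. \<Sum>b<n. f a b * v a * v b) - s\<^sup>2 / d"
      by (cases "d = 0") (auto simp: v'_def d_def[symmetric] field_simps power2_eq_square)
    also have "\<dots> = (\<Sum>i<n. \<Sum>j<n. f' i j * v i * v j)"
      unfolding hh[symmetric] by (simp add: f'_def left_diff_distrib sum_subtractf)
    finally show "0 \<le> (\<Sum>i<n. \<Sum>j<n. f' i j * v i * v j)" .
  qed
  then obtain m :: nat and g where g: "\<And>i j. i < n \<Longrightarrow> j < n \<Longrightarrow> f' i j = (\<Sum>k<m. g k i * g k j)"
    by blast
  define g' where "g' k i = (if k = m then h i else if i = n then 0 else g k i)" for k i
  have "f i j = (\<Sum>k<Suc m. g' k i * g' k j)" if ij: "i < Suc n" "j < Suc n" for i j
  proof (cases "i < n \<and> j < n")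
    case True
    have "(\<Sum>k<m. g' k i * g' k j) = (\<Sum>k<m. g k i * g k j)"
      using True by (intro sum.cong) (auto simp: g'_def)
    then show ?thesis using g[of i j] True by (simp add: f'_def g'_def)
  next
    case False
    then have "(\<Sum>k<m. g' k i * g' k j) = 0"
      using ij by (intro sum.neutral) (auto simp: g'_def less_Suc_eq)
    moreover have "h i * h j = f i j"
      using False ij hn[of i] hn[of j] sym[of i j] by (auto simp: less_Suc_eq mult.commute)
    ultimately show ?thesis by (simp add: g'_def)
  qed
  then show ?case by blast
qed

lemma psd_gram_mat:
  assumes "psd n X"
  shows "\<exists>(m::nat) g. (\<forall>k<m. g k \<in> carrier_vec n) \<and>
    (\<forall>i<n. \<forall>j<n. X $$ (i, j) = (\<Sum>k<m. g k $ i * g k $ j))"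
proof -
  have S: "X \<in> sym_mats n" using assms by (simp add: psd_def)
  then have X: "X \<in> carrier_mat n n" by (simp add: sym_mats_def)
  note s = sym_mats_entry[OF S]
  have "0 \<le> (\<Sum>i<n. \<Sum>j<n. X $$ (i, j) * v i * v j)" for v
  proof -
    have "0 \<le> vec n v \<bullet> (X *\<^sub>v vec n v)" using assms by (simp add: psd_def)
    then show ?thesis by (simp add: scalar_prod_mult_mat_vec_sum[OF X])
  qed
  from psd_gram[of n "\<lambda>i j. X $$ (i, j)", OF s this] obtain m :: nat and g where
    g: "\<forall>i<n. \<forall>j<n. X $$ (i, j) = (\<Sum>k<m. g k i * g k j)" by blast
  show ?thesis
    by (rule exI[of _ m], rule exI[of _ "\<lambda>k. vec n (g k)"]) (use g in auto)
qed

lemma mat_inner_sum: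
  assumes "A \<in> carrier_mat n n" "X \<in> carrier_mat n n"
  shows "mat_inner A X = (\<Sum>i<n. \<Sum>j<n. A $$ (i, j) * X $$ (i, j))"
proof -
  have "mat_inner A X = (\<Sum>j<n. \<Sum>i<n. A $$ (i, j) * X $$ (i, j))"
    using assms by (auto simp: mat_inner_def mat_trace_def scalar_prod_def
        lessThan_atLeast0 intro!: sum.cong)
  then show ?thesis by (subst sum.swap)
qed

lemma mat_inner_gram:
  assumes A: "A \<in> carrier_mat n n" and X: "X \<in> carrier_mat n n"
    and g: "\<And>k. k < m \<Longrightarrow> g k \<in> carrier_vec n"
    and Xg: "\<And>i j. i < n \<Longrightarrow> j < n \<Longrightarrow> X $$ (i, j) = (\<Sum>k<m. g k $ i * g k $ j)"
  shows "mat_inner A X = (\<Sum>k<m. g k \<bullet> (A *\<^sub>v g k))"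
proof -
  have "mat_inner A X = (\<Sum>i<n. \<Sum>j<n. \<Sum>k<m. A $$ (i, j) * g k $ i * g k $ j)"
    unfolding mat_inner_sum[OF A X]
    by (intro sum.cong refl) (simp add: Xg sum_distrib_left mult_ac)
  also have "\<dots> = (\<Sum>i<n. \<Sum>k<m. \<Sum>j<n. A $$ (i, j) * g k $ i * g k $ j)"
    by (intro sum.cong refl sum.swap)
  also have "\<dots> = (\<Sum>k<m. \<Sum>i<n. \<Sum>j<n. A $$ (i, j) * g k $ i * g k $ j)"
    by (rule sum.swap)
  also have "\<dots> = (\<Sum>k<m. g k \<bullet> (A *\<^sub>v g k))"
    by (intro sum.cong refl) (simp add: scalar_prod_mult_mat_vec_sum[OF A] g)
  finally show ?thesis .
qed

section \<open>Spectrum and rank of matrices coercive on a hyperplane\<close>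

lemma outer_mult_vec:
  assumes "z \<in> carrier_vec n" "v \<in> carrier_vec n"
  shows "outer z *\<^sub>v v = (z \<bullet> v) \<cdot>\<^sub>v z"
  using assms by (intro eq_vecI)
    (auto simp: outer_def scalar_prod_def sum_distrib_left sum_distrib_right mult_ac intro!: sum.cong)

lemma sym_mats_real_eigenvalues:
  fixes A :: "real mat"
  assumes A: "A \<in> sym_mats n" and ev: "eigenvalue (map_mat complex_of_real A) a"
  shows "a \<in> \<real>"
proof -
  have A': "A \<in> carrier_mat n n" using A by (auto simp: sym_mats_def)
  from ev obtain v where v: "v \<in> carrier_vec n" "v \<noteq> 0\<^sub>v n"
    and Av: "map_mat complex_of_real A *\<^sub>v v = a \<cdot>\<^sub>v v"
    using A' unfolding eigenvalue_def eigenvector_def by auto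
  define x where "x = vec n (\<lambda>i. Re (v $ i))"
  define y where "y = vec n (\<lambda>i. Im (v $ i))"
  have xy: "x \<in> carrier_vec n" "y \<in> carrier_vec n" by (auto simp: x_def y_def)
  have e: "(\<Sum>j<n. complex_of_real (A $$ (i, j)) * v $ j) = a * v $ i" if "i < n" for i
  proof -
    have "(map_mat complex_of_real A *\<^sub>v v) $ i = a * v $ i" using Av v that by simp
    then show ?thesis using A' v that by (simp add: scalar_prod_def lessThan_atLeast0)
  qed
  have Ax: "A *\<^sub>v x = Re a \<cdot>\<^sub>v x + (- Im a) \<cdot>\<^sub>v y"
  proof (rule eq_vecI)
    fix i assume "i < dim_vec (Re a \<cdot>\<^sub>v x + (- Im a) \<cdot>\<^sub>v y)"
    then have i: "i < n" by (simp add: y_def)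
    show "(A *\<^sub>v x) $ i = (Re a \<cdot>\<^sub>v x + (- Im a) \<cdot>\<^sub>v y) $ i"
      using arg_cong[OF e[OF i], of Re] A' i
      by (simp add: x_def y_def scalar_prod_def lessThan_atLeast0)
  qed (use A' in \<open>auto simp: y_def\<close>)
  have Ay: "A *\<^sub>v y = Im a \<cdot>\<^sub>v x + Re a \<cdot>\<^sub>v y"
  proof (rule eq_vecI)
    fix i assume "i < dim_vec (Im a \<cdot>\<^sub>v x + Re a \<cdot>\<^sub>v y)"
    then have i: "i < n" by (simp add: y_def)
    show "(A *\<^sub>v y) $ i = (Im a \<cdot>\<^sub>v x + Re a \<cdot>\<^sub>v y) $ i"
      using arg_cong[OF e[OF i], of Im] A' i
      by (simp add: x_def y_def scalar_prod_def lessThan_atLeast0)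
  qed (use A' in \<open>auto simp: y_def\<close>)
  \<comment> \<open>Comparing the two sides leaves \<open>Im a\<close> times the squared norm of \<open>v = x + iy\<close>.\<close>
  have "y \<bullet> (A *\<^sub>v x) = x \<bullet> (A *\<^sub>v y)"
    by (rule sym_mats_scalar_prod_commute[OF A xy(2,1)])
  then have "Im a * (x \<bullet> x + y \<bullet> y) = 0"
    unfolding Ax Ay using xy comm_scalar_prod[OF xy]
    by (simp add: scalar_prod_add_distrib[of _ n] algebra_simps)
  moreover have "x \<bullet> x + y \<bullet> y \<noteq> 0"
  proof
    assume "x \<bullet> x + y \<bullet> y = 0"
    then have "x \<bullet> x = 0" "y \<bullet> y = 0"
      using scalar_prod_self_nonneg[of x] scalar_prod_self_nonneg[of y] by auto
    then have 0: "x = 0\<^sub>v n" "y = 0\<^sub>v n"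
      using scalar_prod_self_eq_0 xy by blast+
    have "v = 0\<^sub>v n"
    proof (rule eq_vecI)
      fix i assume "i < dim_vec (0\<^sub>v n :: complex vec)"
      then show "v $ i = 0\<^sub>v n $ i"
        using arg_cong[OF 0(1), of "\<lambda>u. u $ i"] arg_cong[OF 0(2), of "\<lambda>u. u $ i"]
        by (simp add: x_def y_def complex_eq_iff)
    qed (use v in auto)
    with v show False by simp
  qed
  ultimately show ?thesis by (simp add: complex_is_Real_iff)
qed

text \<open>The list of roots is ascending, whereas \<^const>\<open>eig\<close> numbers eigenvalues in descending order.\<close>

lemma sym_mats_char_poly_splits:
  fixes A :: "real mat"
  assumes A: "A \<in> sym_mats n"
  shows "\<exists>as. sorted as \<and> length as = n \<and> char_poly A = (\<Prod>a\<leftarrow>as. [:- a, 1:])"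
proof -
  have A': "A \<in> carrier_mat n n" using A by (auto simp: sym_mats_def)
  define B where "B = map_mat complex_of_real A"
  have B: "B \<in> carrier_mat n n" using A' by (simp add: B_def)
  obtain as where as: "char_poly B = (\<Prod>a\<leftarrow>as. [:- a, 1:])" "length as = n"
    using char_poly_factorized[OF B] by blast
  define rs where "rs = sort (map Re as)"
  have "of_real (Re a) = a" if "a \<in> set as" for a
  proof -
    have "poly (char_poly B) a = 0" unfolding as(1) using that by (rule linear_poly_root)
    then have "eigenvalue B a" using eigenvalue_root_char_poly[OF B] by simp
    then show ?thesis using sym_mats_real_eigenvalues[OF A] B_def by simp
  qed
  then have "map (\<lambda>a. [:- of_real (Re a), 1:]) as = map (\<lambda>a. [:- a, 1:]) as"
    by simp
  then have "map_poly complex_of_real (char_poly A) = (\<Prod>a\<leftarrow>as. [:- of_real (Re a), 1:])"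
    using as(1) unfolding B_def of_real_hom.char_poly_hom[OF A'] by (metis (mono_tags))
  also have "\<dots> = map_poly complex_of_real (\<Prod>a\<leftarrow>map Re as. [:- a, 1:])"
  proof -
    interpret h: map_poly_comm_ring_hom complex_of_real ..
    show ?thesis by (induction as) (simp_all add: h.hom_mult del: mult_pCons_left)
  qed
  finally have "char_poly A = (\<Prod>a\<leftarrow>map Re as. [:- a, 1:])"
    by (simp add: poly_eq_iff coeff_map_poly)
  also have "\<dots> = (\<Prod>a\<leftarrow>rs. [:- a, 1:])"
  proof -
    have "mset rs = mset (map Re as)" unfolding rs_def by (rule mset_sort)
    then have "mset (map (\<lambda>a. [:- a, 1:]) rs) = mset (map (\<lambda>a. [:- a, 1:]) (map Re as))"
      by (metis mset_map)
    then show ?thesis by (metis prod_mset_prod_list)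
  qed
  finally show ?thesis using as(2) by (intro exI[of _ rs]) (auto simp: rs_def)
qed

lemma eig_conv_nth:
  assumes "char_poly A = (\<Prod>a\<leftarrow>as. [:- a, 1:])" "sorted as" "length as = n" "1 \<le> k" "k \<le> n"
  shows "eig k A = as ! (n - k)"
proof -
  have "proots (\<Prod>a\<leftarrow>as. [:- a, 1:]) = mset as"
  proof (induction as)
    case (Cons b bs)
    have "(\<Prod>a\<leftarrow>bs. [:- a, 1:]) \<noteq> 0" by (auto simp: prod_list_zero_iff)
    then have "proots ([:- b, 1:] * (\<Prod>a\<leftarrow>bs. [:- a, 1:])) = add_mset b (mset bs)"
      using Cons by (subst proots_mult) auto
    then show ?case by simp
  qed simp
  then have "eig k A = rev as ! (k - 1)"
    using assms by (simp add: eig_def sorted_sort_id)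
  also have "\<dots> = as ! (n - k)" using assms by (simp add: rev_nth)
  finally show ?thesis .
qed

text \<open>When \<open>Z z = 0\<close>, the quadratic form of \<open>Z\<close> only sees the component orthogonal to \<open>z\<close>.\<close>

lemma coercive_decompose:
  fixes Z :: "real mat"
  assumes Z: "Z \<in> sym_mats n" and z: "z \<in> carrier_vec n" "z \<bullet> z \<noteq> 0" "Z *\<^sub>v z = 0\<^sub>v n"
    and v: "v \<in> carrier_vec n"
  obtains \<alpha> w where "w \<in> carrier_vec n" "z \<bullet> w = 0" "v = w + \<alpha> \<cdot>\<^sub>v z"
    "v \<bullet> (Z *\<^sub>v v) = w \<bullet> (Z *\<^sub>v w)" 
proof -
  define \<alpha> where "\<alpha> = (z \<bullet> v) / (z \<bullet> z)"
  define w where "w = v - \<alpha> \<cdot>\<^sub>v z"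
  have w: "w \<in> carrier_vec n" using v z by (simp add: w_def)
  have 1: "z \<bullet> w = 0"
    using v z by (simp add: w_def scalar_prod_minus_distrib[of _ n] \<alpha>_def)
  have 2: "v = w + \<alpha> \<cdot>\<^sub>v z" using v z by (auto simp: w_def)
  have "z \<bullet> (Z *\<^sub>v w) = w \<bullet> (Z *\<^sub>v z)"
    by (rule sym_mats_scalar_prod_commute[OF Z z(1) w])
  then have "v \<bullet> (Z *\<^sub>v v) = w \<bullet> (Z *\<^sub>v w)"
    unfolding 2 quadratic_form_combination[OF Z w z(1)] using z w by simp
  with w 1 2 show ?thesis by (rule that)
qed

text \<open>The facts that follow concern a symmetric matrix \<open>Z\<close> that annihilates a nonzero vector \<open>z\<close> and
  satisfies \<open>v \<bullet> Z v \<ge> c (v \<bullet> v)\<close> with \<open>c > 0\<close> on the orthogonal complement of \<open>z\<close>.\<close>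

context
  fixes n :: nat and Z :: "real mat" and z :: "real vec" and c :: real
  assumes Z: "Z \<in> sym_mats n" and z: "z \<in> carrier_vec n" "z \<bullet> z \<noteq> 0" and Zz: "Z *\<^sub>v z = 0\<^sub>v n"
    and c: "0 < c"
    and coercive: "\<And>v. v \<in> carrier_vec n \<Longrightarrow> z \<bullet> v = 0 \<Longrightarrow> c * (v \<bullet> v) \<le> v \<bullet> (Z *\<^sub>v v)"
begin

lemma coercive_psd: "psd n Z"
  unfolding psd_def
proof (intro conjI Z ballI)
  fix v :: "real vec" assume v: "v \<in> carrier_vec n"
  from coercive_decompose[OF Z z Zz v] obtain w where
    w: "w \<in> carrier_vec n" "z \<bullet> w = 0" "v \<bullet> (Z *\<^sub>v v) = w \<bullet> (Z *\<^sub>v w)" by metis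
  have "0 \<le> c * (w \<bullet> w)" using c scalar_prod_self_nonneg[of w] by simp
  with coercive[OF w(1,2)] w(3) show "0 \<le> v \<bullet> (Z *\<^sub>v v)" by simp
qed

lemma coercive_null_space:
  assumes v: "v \<in> carrier_vec n" "v \<bullet> (Z *\<^sub>v v) = 0"
  shows "\<exists>\<alpha>. v = \<alpha> \<cdot>\<^sub>v z"
proof -
  from coercive_decompose[OF Z z Zz v(1)] obtain w \<alpha> where
    w: "w \<in> carrier_vec n" "z \<bullet> w = 0" "v = w + \<alpha> \<cdot>\<^sub>v z" "v \<bullet> (Z *\<^sub>v v) = w \<bullet> (Z *\<^sub>v w)" by metis
  have "c * (w \<bullet> w) \<le> 0" using coercive[OF w(1,2)] w(4) v(2) by simp
  then have "w \<bullet> w = 0"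
    using c scalar_prod_self_nonneg[of w] by (simp add: mult_le_0_iff)
  then have "w = 0\<^sub>v n" using w(1) scalar_prod_self_eq_0 by blast
  then show ?thesis using w(3) z by auto
qed

lemma coercive_eigenvalue:
  assumes "eigenvalue Z a"
  shows "a = 0 \<or> c \<le> a"
proof (cases "a = 0")
  case False
  have Z': "Z \<in> carrier_mat n n" using Z by (auto simp: sym_mats_def)
  from assms obtain v where v: "v \<in> carrier_vec n" "v \<noteq> 0\<^sub>v n" and Zv: "Z *\<^sub>v v = a \<cdot>\<^sub>v v"
    using Z' unfolding eigenvalue_def eigenvector_def by auto
  have "a * (z \<bullet> v) = z \<bullet> (Z *\<^sub>v v)" using v z by (simp add: Zv)
  also have "\<dots> = v \<bullet> (Z *\<^sub>v z)" by (rule sym_mats_scalar_prod_commute[OF Z z(1) v(1)])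
  also have "\<dots> = 0" using v by (simp add: Zz)
  finally have "z \<bullet> v = 0" using False by simp
  then have "c * (v \<bullet> v) \<le> a * (v \<bullet> v)" using coercive[OF v(1)] v(1) Zv by simp
  moreover have "v \<bullet> v > 0"
    using scalar_prod_self_nonneg[of v] scalar_prod_self_eq_0[OF v(1)] v(2) by force
  ultimately show ?thesis by simp
qed simp

text \<open>Every eigenvalue is \<open>0\<close> or at least \<open>c\<close>, so it remains to see that \<open>0\<close> is a simple root of the
  characteristic polynomial. Otherwise a Schur form \<open>B = Q Z P\<close>, with \<open>Q\<close> inverse to \<open>P\<close>,
  could be chosen whose first two diagonal entries vanish; then \<open>Z\<close> maps the second column of \<open>P\<close> to a multiple of the first, and the
  first to zero. Symmetry of \<open>Z\<close> puts both columns in the kernel, which is spanned by \<open>z\<close>,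
  contradicting their independence.\<close>

lemma coercive_eig:
  assumes n: "2 \<le> n"
  shows "c \<le> eig (n - 1) Z"
proof (rule ccontr)
  assume lt: "\<not> c \<le> eig (n - 1) Z"
  have Z': "Z \<in> carrier_mat n n" using Z by (auto simp: sym_mats_def)
  obtain as where as: "sorted as" "length as = n" and cp: "char_poly Z = (\<Prod>a\<leftarrow>as. [:- a, 1:])"
    using sym_mats_char_poly_splits[OF Z] by blast
  have "eig (n - 1) Z = as ! 1"
    using eig_conv_nth[OF cp as, of "n - 1"] n by (simp add: numeral_2_eq_2)
  then have lt1: "as ! 1 < c" using lt by simp
  have mono: "as ! 0 \<le> as ! 1" using as n by (intro sorted_nth_mono) auto
  have root: "as ! i = 0 \<or> c \<le> as ! i" if "i < n" for i
  proof -
    have "poly (char_poly Z) (as ! i) = 0"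
      unfolding cp using that as by (intro linear_poly_root) auto
    then show ?thesis using eigenvalue_root_char_poly[OF Z'] coercive_eigenvalue by blast
  qed
  have as0: "as ! 0 = 0" "as ! 1 = 0"
    using root[of 0] root[of 1] lt1 mono n by auto
  obtain B P Q where BPQ: "schur_decomposition Z as = (B, P, Q)" by (metis prod_cases3)
  from schur_decomposition[OF Z' cp BPQ] have sim: "similar_mat_wit Z B P Q"
    and ut: "upper_triangular B" and dg: "diag_mat B = as" by auto
  note D = similar_mat_witD2[OF Z' sim]
  have B00: "B $$ (0, 0) = 0" "B $$ (1, 1) = 0"
    using arg_cong[OF dg, of "\<lambda>l. l ! 0"] arg_cong[OF dg, of "\<lambda>l. l ! 1"] as0 D(5) n
    by (auto simp: diag_mat_def)
  have Be0: "B *\<^sub>v unit_vec n 0 = 0\<^sub>v n"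
  proof (rule eq_vecI)
    fix i assume "i < dim_vec (0\<^sub>v n :: real vec)"
    then show "(B *\<^sub>v unit_vec n 0) $ i = 0\<^sub>v n $ i"
      using D(5) B00 upper_triangularD[OF ut, of 0 i] n by (cases "i = 0") auto
  qed (use D(5) in auto)
  have Be1: "B *\<^sub>v unit_vec n 1 = B $$ (0, 1) \<cdot>\<^sub>v unit_vec n 0"
  proof (rule eq_vecI)
    fix i assume "i < dim_vec (B $$ (0, 1) \<cdot>\<^sub>v (unit_vec n 0 :: real vec))"
    then show "(B *\<^sub>v unit_vec n 1) $ i = (B $$ (0, 1) \<cdot>\<^sub>v unit_vec n 0) $ i"
      using D(5) B00 upper_triangularD[OF ut, of 1 i] n
      by (cases "i = 0"; cases "i = 1") auto
  qed (use D(5) in auto)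
  have QP: "Q *\<^sub>v (P *\<^sub>v u) = u" if u: "u \<in> carrier_vec n" for u
  proof -
    have "Q *\<^sub>v (P *\<^sub>v u) = (Q * P) *\<^sub>v u"
      by (rule assoc_mult_mat_vec[symmetric, of _ n n _ n]) (use D u in auto)
    also have "\<dots> = u" unfolding D(2) using u by simp
    finally show ?thesis .
  qed
  then have inj: "u = u'"
    if "P *\<^sub>v u = P *\<^sub>v u'" "u \<in> carrier_vec n" "u' \<in> carrier_vec n" for u u'
    using that by metis
  have ZP: "Z *\<^sub>v (P *\<^sub>v u) = P *\<^sub>v (B *\<^sub>v u)" if u: "u \<in> carrier_vec n" for u
  proof -
    have "Z *\<^sub>v (P *\<^sub>v u) = (P * B) *\<^sub>v (Q *\<^sub>v (P *\<^sub>v u))"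
      unfolding D(3) using D(5-7) u by (subst assoc_mult_mat_vec[of _ n n _ n]) auto
    then show ?thesis using D(5-7) u by (simp add: QP)
  qed
  define p where "p = P *\<^sub>v unit_vec n 0"
  define q where "q = P *\<^sub>v unit_vec n 1"
  have pq: "p \<in> carrier_vec n" "q \<in> carrier_vec n" using D by (auto simp: p_def q_def)
  have "P *\<^sub>v 0\<^sub>v n = 0\<^sub>v n" by (rule eq_vecI) (use D(6) in auto)
  then have Zp: "Z *\<^sub>v p = 0\<^sub>v n" by (simp add: p_def ZP Be0)
  have Zq: "Z *\<^sub>v q = B $$ (0, 1) \<cdot>\<^sub>v p"
  proof -
    have "Z *\<^sub>v q = P *\<^sub>v (B *\<^sub>v unit_vec n 1)" unfolding q_def by (rule ZP) simp
    also have "\<dots> = B $$ (0, 1) \<cdot>\<^sub>v p" unfolding Be1 p_def by (rule mult_mat_vec[OF D(6)]) simp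
    finally show ?thesis .
  qed
  obtain \<alpha> where \<alpha>: "p = \<alpha> \<cdot>\<^sub>v z" using coercive_null_space[OF pq(1)] Zp pq by auto
  have zZq: "z \<bullet> (Z *\<^sub>v q) = 0"
    using sym_mats_scalar_prod_commute[OF Z z(1) pq(2)] Zz pq by simp
  have "q \<bullet> (Z *\<^sub>v q) = 0"
  proof -
    have "B $$ (0, 1) * (\<alpha> * (z \<bullet> z)) = 0" using zZq z by (simp add: Zq \<alpha>)
    then have "B $$ (0, 1) = 0 \<or> \<alpha> = 0" using z by simp
    then show ?thesis using pq z by (auto simp: Zq \<alpha>)
  qed
  then obtain \<beta> where \<beta>: "q = \<beta> \<cdot>\<^sub>v z" using coercive_null_space[OF pq(2)] by auto
  have "P *\<^sub>v (\<beta> \<cdot>\<^sub>v unit_vec n 0) = P *\<^sub>v (\<alpha> \<cdot>\<^sub>v unit_vec n 1)"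
  proof -
    have "P *\<^sub>v (\<beta> \<cdot>\<^sub>v unit_vec n 0) = \<beta> \<cdot>\<^sub>v p"
      unfolding p_def by (rule mult_mat_vec[OF D(6)]) simp
    also have "\<dots> = \<alpha> \<cdot>\<^sub>v q"
      unfolding \<alpha> \<beta> by (simp add: smult_smult_assoc mult.commute)
    also have "\<dots> = P *\<^sub>v (\<alpha> \<cdot>\<^sub>v unit_vec n 1)"
      unfolding q_def by (rule mult_mat_vec[OF D(6), symmetric]) simp
    finally show ?thesis .
  qed
  then have eq: "\<beta> \<cdot>\<^sub>v unit_vec n 0 = \<alpha> \<cdot>\<^sub>v (unit_vec n 1 :: real vec)" by (rule inj) auto
  have "\<alpha> = 0" using arg_cong[OF eq, of "\<lambda>u. u $ 1"] n by simp
  then have "P *\<^sub>v unit_vec n 0 = P *\<^sub>v 0\<^sub>v n"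
    using \<alpha> z D by (auto simp: p_def[symmetric])
  then have "unit_vec n 0 = (0\<^sub>v n :: real vec)" by (rule inj) auto
  from arg_cong[OF this, of "\<lambda>u. u $ 0"] show False using n by simp
qed

text \<open>The sum \<open>z z\<^sup>T + Z\<close> is positive definite, hence of rank \<open>n\<close>, while the summands have rank at
  most \<open>1\<close> and \<open>n - 1\<close>; subadditivity of the rank forces equality.\<close>

lemma coercive_rank: "mat_rank (outer z) + mat_rank Z = n"
proof -
  have Z': "Z \<in> carrier_mat n n" using Z by (auto simp: sym_mats_def)
  have O: "outer z \<in> carrier_mat n n" using z by (auto simp: outer_def)
  interpret V: vec_space "TYPE(real)" n .
  have z0: "z \<noteq> 0\<^sub>v n" using z by auto
  have "det Z = 0" using det_0_iff_vec_prod_zero_field[OF Z'] z Zz z0 by blast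
  then have "V.rank Z \<noteq> n" using V.det_rank_iff[OF Z'] by simp
  moreover have "V.rank Z \<le> n" by (rule V.rank_le_nc[OF Z'])
  moreover have "V.rank (outer z) \<le> 1"
    by (rule V.rank_le_1_product_entries[OF O, of "\<lambda>i. z $ i" "\<lambda>i. z $ i"]) (simp add: outer_def)
  moreover have "n \<le> V.rank (outer z) + V.rank Z"
  proof -
    have "det (outer z + Z) \<noteq> 0"
    proof
      assume "det (outer z + Z) = 0"
      then obtain v where v: "v \<in> carrier_vec n" "v \<noteq> 0\<^sub>v n" "(outer z + Z) *\<^sub>v v = 0\<^sub>v n"
        using det_0_iff_vec_prod_zero_field[of "outer z + Z" n] O Z' by auto
      have "0 = v \<bullet> ((outer z + Z) *\<^sub>v v)" using v by simp
      also have "\<dots> = (z \<bullet> v)\<^sup>2 + v \<bullet> (Z *\<^sub>v v)"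
        using O Z' v(1) z comm_scalar_prod[OF z(1) v(1)]
        by (simp add: add_mult_distrib_mat_vec[of _ n n] scalar_prod_add_distrib[of _ n]
            outer_mult_vec[OF z(1)] power2_eq_square)
      finally have "(z \<bullet> v)\<^sup>2 + v \<bullet> (Z *\<^sub>v v) = 0" by simp
      moreover have "0 \<le> v \<bullet> (Z *\<^sub>v v)" using coercive_psd v by (auto simp: psd_def)
      ultimately have 0: "z \<bullet> v = 0" "v \<bullet> (Z *\<^sub>v v) = 0"
        by (auto simp: add_nonneg_eq_0_iff)
      from coercive_null_space[OF v(1) 0(2)] obtain \<alpha> where "v = \<alpha> \<cdot>\<^sub>v z" by blast
      with 0 v z show False by auto
    qed
    then have "V.rank (outer z + Z) = n" using V.det_rank_iff[of "outer z + Z"] O Z' by auto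
    then show ?thesis using V.rank_subadditive[OF O Z'] by simp
  qed
  ultimately have "V.rank (outer z) + V.rank Z = n" by linarith
  then show ?thesis using O Z' by (simp add: mat_rank_def)
qed

end

section \<open>Optimality conditions for the diagonally constrained program\<close>

lemma mat_inner_psd_nonneg:
  assumes A: "psd n A" and X: "psd n X"
  shows "0 \<le> mat_inner A X"
proof -
  from psd_gram_mat[OF X] obtain m :: nat and g where g: "\<And>k. k < m \<Longrightarrow> g k \<in> carrier_vec n"
    and Xg: "\<And>i j. i < n \<Longrightarrow> j < n \<Longrightarrow> X $$ (i, j) = (\<Sum>k<m. g k $ i * g k $ j)" by blast
  have "A \<in> carrier_mat n n" "X \<in> carrier_mat n n"
    using A X by (auto simp: psd_def sym_mats_def)
  then have "mat_inner A X = (\<Sum>k<m. g k \<bullet> (A *\<^sub>v g k))" using g Xg by (rule mat_inner_gram)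
  also have "0 \<le> \<dots>" using A g by (intro sum_nonneg) (auto simp: psd_def)
  finally show ?thesis .
qed

lemma mat_inner_outer:
  assumes "A \<in> carrier_mat n n" "z \<in> carrier_vec n"
  shows "mat_inner A (outer z) = z \<bullet> (A *\<^sub>v z)"
proof -
  have "mat_inner A (outer z) = (\<Sum>k<1::nat. z \<bullet> (A *\<^sub>v z))"
    by (rule mat_inner_gram[OF assms(1)]) (use assms in \<open>auto simp: outer_def\<close>)
  then show ?thesis by simp
qed

lemma psd_outer:
  assumes "z \<in> carrier_vec n"
  shows "psd n (outer z)"
proof -
  have "0 \<le> v \<bullet> (outer z *\<^sub>v v)" if v: "v \<in> carrier_vec n" for v
  proof -
    have "v \<bullet> (outer z *\<^sub>v v) = (\<Sum>i<n. z $ i * v $ i) * (\<Sum>j<n. z $ j * v $ j)"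
      using assms v
      by (subst scalar_prod_mult_mat_vec_sum[of _ n])
        (auto simp: outer_def sum_product mult_ac intro!: sum.cong)
    then show ?thesis by simp
  qed
  then show ?thesis
    using assms by (auto simp: psd_def sym_mats_def outer_def)
qed

lemma primal_feasible_diag_sdp:
  assumes "Y \<in> carrier_mat n n"
  shows "primal_feasible (diag_sdp Y) X \<longleftrightarrow> psd n X \<and> (\<forall>i<n. X $$ (i, i) = 1)"
proof (cases "psd n X")
  case True
  then have "X \<in> carrier_mat n n" by (auto simp: psd_def sym_mats_def)
  from constraint_map_diag_sdp[OF assms this] show ?thesis
    using True assms by (auto simp: primal_feasible_def diag_sdp_def vec_eq_iff)
qed (use assms in \<open>auto simp: primal_feasible_def diag_sdp_def\<close>)

lemma dual_feasible_diag_sdp: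
  assumes "Y \<in> carrier_mat n n"
  shows "dual_feasible (diag_sdp Y) y \<longleftrightarrow> y \<in> carrier_vec n \<and> psd n (- Y - Diag y)"
  using assms slack_diag_sdp[OF assms, of y] by (auto simp: dual_feasible_def diag_sdp_def)

text \<open>On matrices with unit diagonal, the duality gap is the inner product with the slack matrix.\<close>

lemma diag_sdp_objective_gap:
  assumes Y: "Y \<in> carrier_mat n n" and X: "X \<in> carrier_mat n n" "\<And>i. i < n \<Longrightarrow> X $$ (i, i) = 1"
    and y: "y \<in> carrier_vec n"
  shows "mat_inner (sdp_C (diag_sdp Y)) X = mat_inner (- Y - Diag y) X + sdp_b (diag_sdp Y) \<bullet> y"
proof -
  have "mat_inner (- Y - Diag y) X =
      (\<Sum>i<n. \<Sum>j<n. (- Y) $$ (i, j) * X $$ (i, j) - (if j = i then y $ i else 0))"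
    using Y X y by (subst mat_inner_sum[of _ n])
      (auto simp: Diag_def mat_diag_def algebra_simps intro!: sum.cong)
  also have "\<dots> = mat_inner (- Y) X - (\<Sum>i<n. y $ i)"
    using Y X by (subst mat_inner_sum[of _ n]) (auto simp: sum_subtractf)
  also have "(\<Sum>i<n. y $ i) = sdp_b (diag_sdp Y) \<bullet> y"
    using Y y by (simp add: diag_sdp_def scalar_prod_def lessThan_atLeast0)
  finally show ?thesis by (simp add: diag_sdp_def)
qed

lemma surjective_constraint_map_diag_sdp:
  assumes Y: "Y \<in> carrier_mat n n"
  shows "surjective_constraint_map (diag_sdp Y)"
proof -
  have "constraint_map (diag_sdp Y) ` sym_mats n = carrier_vec n"
  proof (intro equalityI subsetI)
    fix b :: "real vec" assume b: "b \<in> carrier_vec n"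
    have D: "Diag b \<in> sym_mats n"
      using b by (auto simp: Diag_def mat_diag_def sym_mats_def)
    then have "Diag b \<in> carrier_mat n n" by (simp add: sym_mats_def)
    from constraint_map_diag_sdp[OF Y this] have "constraint_map (diag_sdp Y) (Diag b) = b"
      using b by (auto simp: Diag_def mat_diag_def)
    with D show "b \<in> constraint_map (diag_sdp Y) ` sym_mats n" by force
  next
    fix b assume "b \<in> constraint_map (diag_sdp Y) ` sym_mats n"
    then show "b \<in> carrier_vec n"
      using constraint_map_diag_sdp[OF Y] by (auto simp: sym_mats_def)
  qed
  then show ?thesis using Y by (simp add: surjective_constraint_map_def diag_sdp_def)
qed

text \<open>The only vector \<open>y\<close> for which the slack matrix \<open>- Y - Diag y\<close> annihilates the sign vector
  \<open>z\<close>; see \<open>dual_certificate_unique\<close>. Multiplication by \<open>z $ i\<close> stands for division, as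
  the entries of \<open>z\<close> are signs.\<close>

definition dual_certificate :: "nat \<Rightarrow> real mat \<Rightarrow> real vec \<Rightarrow> real vec" where
  "dual_certificate n Y z = vec n (\<lambda>i. - (z $ i * (Y *\<^sub>v z) $ i))"

lemma sign_vecs_square: "z \<in> sign_vecs n \<Longrightarrow> i < n \<Longrightarrow> z $ i * z $ i = 1"
  by (auto simp: sign_vecs_def)

lemma slack_sym_mats:
  assumes "Y \<in> sym_mats n" "y \<in> carrier_vec n"
  shows "- Y - Diag y \<in> sym_mats n"
proof -
  have Y: "Y \<in> carrier_mat n n" using assms(1) by (simp add: sym_mats_def)
  note s = sym_mats_entry[OF assms(1)]
  show ?thesis
    unfolding sym_mats_def using assms(2) Y s
    by (auto simp: Diag_def mat_diag_def intro!: eq_matI)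
qed

lemma slack_mult_sign_vec:
  assumes Y: "Y \<in> carrier_mat n n" and z: "z \<in> sign_vecs n" and y: "y \<in> carrier_vec n" and i: "i < n"
  shows "((- Y - Diag y) *\<^sub>v z) $ i = - (Y *\<^sub>v z) $ i - y $ i * z $ i"
proof -
  have z': "z \<in> carrier_vec n" using z by (simp add: sign_vecs_def)
  have "((- Y - Diag y) *\<^sub>v z) $ i = (\<Sum>j<n. - (Y $$ (i, j) * z $ j) - (if j = i then y $ i * z $ i else 0))"
  proof -
    have "((- Y - Diag y) *\<^sub>v z) $ i = (\<Sum>j<n. (- Y - Diag y) $$ (i, j) * z $ j)"
      using Y y z' i by (simp add: scalar_prod_def Diag_def mat_diag_def lessThan_atLeast0)
    also have "\<dots> = (\<Sum>j<n. - (Y $$ (i, j) * z $ j) - (if j = i then y $ i * z $ i else 0))"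
      using Y y i by (intro sum.cong refl) (auto simp: Diag_def mat_diag_def left_diff_distrib)
    finally show ?thesis .
  qed
  also have "\<dots> = - (\<Sum>j<n. Y $$ (i, j) * z $ j) - y $ i * z $ i"
    using i by (simp add: sum_subtractf sum_negf)
  also have "(\<Sum>j<n. Y $$ (i, j) * z $ j) = (Y *\<^sub>v z) $ i"
    using Y z' i by (simp add: scalar_prod_def lessThan_atLeast0)
  finally show ?thesis .
qed

lemma dual_certificate_unique:
  assumes Y: "Y \<in> carrier_mat n n" and z: "z \<in> sign_vecs n" and y: "y \<in> carrier_vec n"
  shows "(- Y - Diag y) *\<^sub>v z = 0\<^sub>v n \<longleftrightarrow> y = dual_certificate n Y z"
proof -
  have "(- Y - Diag y) *\<^sub>v z = 0\<^sub>v n \<longleftrightarrow> (\<forall>i<n. - (Y *\<^sub>v z) $ i - y $ i * z $ i = 0)"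
    using slack_mult_sign_vec[OF Y z y] Y y by (auto simp: vec_eq_iff Diag_def mat_diag_def)
  also have "\<dots> \<longleftrightarrow> (\<forall>i<n. y $ i = - (z $ i * (Y *\<^sub>v z) $ i))"
  proof (intro all_cong)
    fix i assume "i < n"
    then have "z $ i = 1 \<or> z $ i = - 1" using z by (simp add: sign_vecs_def)
    then show "(- (Y *\<^sub>v z) $ i - y $ i * z $ i = 0) \<longleftrightarrow> (y $ i = - (z $ i * (Y *\<^sub>v z) $ i))"
      by auto
  qed
  also have "\<dots> \<longleftrightarrow> y = dual_certificate n Y z"
    using y by (auto simp: dual_certificate_def vec_eq_iff)
  finally show ?thesis .
qed

text \<open>The deterministic half of the result. Complementarity with \<open>z z\<^sup>T\<close> forces the dual solution to be
  the certificate, and complementarity with the certificate confines a primal solution to multiples of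
  \<open>z z\<^sup>T\<close>: each vector of its Gram decomposition lies in the kernel of the slack matrix.\<close>

lemma diag_sdp_simple_of_coercive:
  fixes Y :: "real mat"
  assumes Y: "Y \<in> sym_mats n" and z: "z \<in> sign_vecs n" and n: "2 \<le> n" and c: "0 < c"
    and coercive: "\<And>v. v \<in> carrier_vec n \<Longrightarrow> z \<bullet> v = 0 \<Longrightarrow>
      c * (v \<bullet> v) \<le> v \<bullet> ((- Y - Diag (dual_certificate n Y z)) *\<^sub>v v)"
  shows "simple_sdp (diag_sdp Y) \<and> primal_solution (diag_sdp Y) (outer z) \<and>
    (\<forall>y. dual_solution (diag_sdp Y) y \<longrightarrow> c \<le> eig (n - 1) (- Y - Diag y))"
proof -
  let ?P = "diag_sdp Y"
  define y where "y = dual_certificate n Y z"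
  define Z where "Z = - Y - Diag y"
  have Y': "Y \<in> carrier_mat n n" using Y by (auto simp: sym_mats_def)
  have z': "z \<in> carrier_vec n" using z by (simp add: sign_vecs_def)
  have y: "y \<in> carrier_vec n" by (simp add: y_def dual_certificate_def)
  have Z: "Z \<in> sym_mats n" unfolding Z_def by (rule slack_sym_mats[OF Y y])
  then have Z': "Z \<in> carrier_mat n n" by (simp add: sym_mats_def)
  have Zz: "Z *\<^sub>v z = 0\<^sub>v n"
    using dual_certificate_unique[OF Y' z y] by (simp add: Z_def y_def)
  have "z \<bullet> z = (\<Sum>i<n. 1)"
    using z' sign_vecs_square[OF z] by (simp add: scalar_prod_def lessThan_atLeast0)
  then have zz: "z \<bullet> z \<noteq> 0" using n by simp
  have coer: "c * (v \<bullet> v) \<le> v \<bullet> (Z *\<^sub>v v)" if "v \<in> carrier_vec n" "z \<bullet> v = 0" for v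
    using coercive[OF that] by (simp add: Z_def y_def)
  note facts = Z z' zz Zz c coer
  have psdZ: "psd n Z" by (rule coercive_psd[OF facts])
  have feasz: "primal_feasible ?P (outer z)"
    using psd_outer[OF z'] z' sign_vecs_square[OF z]
    by (auto simp: primal_feasible_diag_sdp[OF Y'] outer_def)
  have feasy: "dual_feasible ?P y"
    using psdZ y by (simp add: dual_feasible_diag_sdp[OF Y'] Z_def)
  have gap: "mat_inner (sdp_C ?P) X = mat_inner (- Y - Diag w) X + sdp_b ?P \<bullet> w"
    if "primal_feasible ?P X" "w \<in> carrier_vec n" for X w
    using that diag_sdp_objective_gap[OF Y' _ _ that(2)]
    by (auto simp: primal_feasible_diag_sdp[OF Y'] psd_def sym_mats_def)
  have opt0: "mat_inner Z (outer z) = 0"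
    using z' by (simp add: mat_inner_outer[OF Z' z'] Zz)
  have objz: "mat_inner (sdp_C ?P) (outer z) = sdp_b ?P \<bullet> y"
    using gap[OF feasz y] opt0 by (simp add: Z_def)
  have primal: "primal_solution ?P (outer z)"
    unfolding primal_solution_def
  proof (intro conjI feasz allI impI)
    fix X assume X: "primal_feasible ?P X"
    then have "0 \<le> mat_inner Z X"
      by (intro mat_inner_psd_nonneg[OF psdZ]) (simp add: primal_feasible_diag_sdp[OF Y'])
    then show "mat_inner (sdp_C ?P) (outer z) \<le> mat_inner (sdp_C ?P) X"
      using objz gap[OF X y] by (simp add: Z_def)
  qed
  have weak: "sdp_b ?P \<bullet> w + z \<bullet> ((- Y - Diag w) *\<^sub>v z) = sdp_b ?P \<bullet> y" if "w \<in> carrier_vec n" for w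
  proof -
    have "- Y - Diag w \<in> carrier_mat n n"
      using slack_sym_mats[OF Y that] by (simp add: sym_mats_def)
    from mat_inner_outer[OF this z'] show ?thesis
      using gap[OF feasz that] objz by simp
  qed
  have dual: "dual_solution ?P y"
    unfolding dual_solution_def
  proof (intro conjI feasy allI impI)
    fix w assume "dual_feasible ?P w"
    then have w: "w \<in> carrier_vec n" and "psd n (- Y - Diag w)"
      by (auto simp: dual_feasible_diag_sdp[OF Y'])
    then have "0 \<le> z \<bullet> ((- Y - Diag w) *\<^sub>v z)" using z' by (simp add: psd_def)
    then show "sdp_b ?P \<bullet> w \<le> sdp_b ?P \<bullet> y" using weak[OF w] by simp
  qed
  have primal_unique: "X = outer z" if "primal_solution ?P X" for X
  proof -
    have feas: "primal_feasible ?P X" using that by (simp add: primal_solution_def)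
    then have X: "psd n X" "\<And>i. i < n \<Longrightarrow> X $$ (i, i) = 1"
      by (auto simp: primal_feasible_diag_sdp[OF Y'])
    then have X': "X \<in> carrier_mat n n" by (simp add: psd_def sym_mats_def)
    have "mat_inner (sdp_C ?P) X \<le> mat_inner (sdp_C ?P) (outer z)"
      using that feasz by (simp add: primal_solution_def)
    then have le0: "mat_inner Z X \<le> 0"
      using objz gap[OF feas y] by (simp add: Z_def)
    from psd_gram_mat[OF X(1)] obtain m :: nat and g where g: "\<And>k. k < m \<Longrightarrow> g k \<in> carrier_vec n"
      and Xg: "\<And>i j. i < n \<Longrightarrow> j < n \<Longrightarrow> X $$ (i, j) = (\<Sum>k<m. g k $ i * g k $ j)" by blast
    have nn: "0 \<le> g k \<bullet> (Z *\<^sub>v g k)" if "k < m" for k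
      using psdZ g[OF that] by (simp add: psd_def)
    have "(\<Sum>k<m. g k \<bullet> (Z *\<^sub>v g k)) = 0"
      using le0 mat_inner_gram[OF Z' X' g Xg] nn
      by (intro antisym sum_nonneg) auto
    then have "g k \<bullet> (Z *\<^sub>v g k) = 0" if "k < m" for k
      using nn that by (subst (asm) sum_nonneg_eq_0_iff) auto
    then have "\<forall>k<m. \<exists>\<alpha>. g k = \<alpha> \<cdot>\<^sub>v z"
      using coercive_null_space[OF facts] g by blast
    then obtain \<alpha> where \<alpha>: "\<And>k. k < m \<Longrightarrow> g k = \<alpha> k \<cdot>\<^sub>v z" by metis
    define s where "s = (\<Sum>k<m. \<alpha> k * \<alpha> k)"
    have Xs: "X $$ (i, j) = s * (z $ i * z $ j)" if "i < n" "j < n" for i j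
      unfolding Xg[OF that] s_def sum_distrib_right using \<alpha> z' that
      by (intro sum.cong) auto
    have "s = 1" using Xs[of 0 0] X(2)[of 0] sign_vecs_square[OF z, of 0] n by simp
    then show ?thesis
      using Xs X' z' by (intro eq_matI) (auto simp: outer_def)
  qed
  have dual_unique: "w = y" if "dual_solution ?P w" for w
  proof -
    have w: "w \<in> carrier_vec n" and psdw: "psd n (- Y - Diag w)"
      using that by (auto simp: dual_solution_def dual_feasible_diag_sdp[OF Y'])
    have "sdp_b ?P \<bullet> y \<le> sdp_b ?P \<bullet> w" using that feasy by (simp add: dual_solution_def)
    moreover have "0 \<le> z \<bullet> ((- Y - Diag w) *\<^sub>v z)" using psdw z' by (simp add: psd_def)
    ultimately have "z \<bullet> ((- Y - Diag w) *\<^sub>v z) = 0" using weak[OF w] by simp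
    from psd_quadratic_form_eq_0[OF psdw z' this] show ?thesis
      using dual_certificate_unique[OF Y' z w] by (simp add: y_def)
  qed
  have tr: "mat_trace (sdp_C ?P * X) = mat_inner (sdp_C ?P) X" for X
    using Y by (simp add: mat_inner_def diag_sdp_def sym_mats_def transpose_uminus)
  have rank: "mat_rank (outer z) + mat_rank (slack ?P y) = sdp_n ?P"
    using coercive_rank[OF facts] Y' unfolding slack_diag_sdp[OF Y' y] Z_def
    by (simp add: diag_sdp_def)
  have "strong_duality ?P"
    unfolding strong_duality_def using primal dual primal_unique dual_unique tr objz by metis
  moreover have "strict_complementarity ?P"
    unfolding strict_complementarity_def using primal dual rank by blast
  ultimately have "simple_sdp ?P"
    unfolding simple_sdp_def
    using surjective_constraint_map_diag_sdp[OF Y'] primal dual primal_unique dual_unique by blast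
  moreover have "c \<le> eig (n - 1) (- Y - Diag y)"
    using coercive_eig[OF facts n] by (simp add: Z_def)
  ultimately show ?thesis using primal dual_unique by blast
qed

section \<open>Linear forms in the noise\<close>

text \<open>The positions strictly above the diagonal, which carry the independent entries of the noise.\<close>

definition upper_pairs :: "nat \<Rightarrow> (nat \<times> nat) set" where
  "upper_pairs n = {(i, j). i < j \<and> j < n}"

lemma finite_upper_pairs: "finite (upper_pairs n)"
  by (rule finite_subset[of _ "{..<n} \<times> {..<n}"]) (auto simp: upper_pairs_def)

lemma sum_sum_upper_pairs:
  fixes f :: "nat \<Rightarrow> nat \<Rightarrow> real"
  assumes "\<And>i. i < n \<Longrightarrow> f i i = 0"
  shows "(\<Sum>i<n. \<Sum>j<n. f i j) = (\<Sum>(i, j)\<in>upper_pairs n. f i j + f j i)"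
  using assms
proof (induction n)
  case 0
  then show ?case by (simp add: upper_pairs_def)
next
  case (Suc n)
  have eq: "upper_pairs (Suc n) = upper_pairs n \<union> (\<lambda>i. (i, n)) ` {..<n}"
    by (auto simp: upper_pairs_def less_Suc_eq)
  have "(\<Sum>(i, j)\<in>upper_pairs (Suc n). f i j + f j i) =
      (\<Sum>(i, j)\<in>upper_pairs n. f i j + f j i) + (\<Sum>(i, j)\<in>(\<lambda>i. (i, n)) ` {..<n}. f i j + f j i)"
    unfolding eq by (rule sum.union_disjoint[OF finite_upper_pairs]) (auto simp: upper_pairs_def)
  also have "(\<Sum>(i, j)\<in>(\<lambda>i. (i, n)) ` {..<n}. f i j + f j i) = (\<Sum>i<n. f i n + f n i)"
    by (subst sum.reindex) (auto simp: inj_on_def)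
  finally show ?case using Suc by (simp add: sum.distrib)
qed

lemma std_normal_mgf:
  "(\<integral>\<^sup>+x. ennreal (std_normal_density x) * ennreal (exp (t * x)) \<partial>lborel) = ennreal (exp (t\<^sup>2 / 2))"
proof -
  \<comment> \<open>Completing the square turns the tilted density into a shifted one.\<close>
  have "std_normal_density x * exp (t * x) = exp (t\<^sup>2 / 2) * normal_density t 1 x" for x
    by (simp add: normal_density_def exp_add[symmetric] power2_eq_square field_simps)
  then have "(\<integral>\<^sup>+x. ennreal (std_normal_density x) * ennreal (exp (t * x)) \<partial>lborel) =
      (\<integral>\<^sup>+x. ennreal (exp (t\<^sup>2 / 2)) * ennreal (normal_density t 1 x) \<partial>lborel)"
    by (simp add: ennreal_mult[symmetric])
  also have "\<dots> = ennreal (exp (t\<^sup>2 / 2)) * (\<integral>\<^sup>+x. ennreal (normal_density t 1 x) \<partial>lborel)"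
    by (rule nn_integral_cmult) simp
  also have "(\<integral>\<^sup>+x. ennreal (normal_density t 1 x) \<partial>lborel) = 1"
    by (subst nn_integral_eq_integral) auto
  finally show ?thesis by simp
qed

lemma gaussian_noise_measurable:
  assumes "gaussian_noise n M W" "p \<in> upper_pairs n"
  shows "(\<lambda>\<omega>. W \<omega> $$ p) \<in> borel_measurable M"
proof -
  interpret prob_space M using assms(1) by (simp add: gaussian_noise_def)
  show ?thesis
    using assms unfolding gaussian_noise_def indep_vars_def upper_pairs_def by auto
qed

text \<open>Chernoff bound for a linear combination of the noise entries, whose variance is the sum of the
  squared coefficients.\<close>

lemma gaussian_noise_tail:
  fixes c :: "nat \<times> nat \<Rightarrow> real"
  assumes W: "gaussian_noise n M W" and t: "t > 0" and V: "V > 0"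
    and cV: "(\<Sum>p\<in>upper_pairs n. (c p)\<^sup>2) \<le> V"
  shows "measure M {\<omega> \<in> space M. t \<le> (\<Sum>p\<in>upper_pairs n. c p * W \<omega> $$ p)} \<le> exp (- t\<^sup>2 / (2 * V))"
proof -
  interpret prob_space M using W by (simp add: gaussian_noise_def)
  let ?P = "upper_pairs n"
  have meas[measurable]: "(\<lambda>\<omega>. W \<omega> $$ p) \<in> borel_measurable M" if "p \<in> ?P" for p
    by (rule gaussian_noise_measurable[OF W that])
  \<comment> \<open>The exponent that minimises \<open>s\<^sup>2 V / 2 - s t\<close>.\<close>
  define s where "s = t / V"
  have s: "s > 0" using t V by (simp add: s_def)
  have indep: "indep_vars (\<lambda>_. borel) (\<lambda>p \<omega>. W \<omega> $$ p) ?P"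
    using W by (simp add: gaussian_noise_def upper_pairs_def)
  have one: "(\<integral>\<^sup>+\<omega>. ennreal (exp (s * c p * W \<omega> $$ p)) \<partial>M) = ennreal (exp ((s * c p)\<^sup>2 / 2))"
    if "p \<in> ?P" for p
  proof -
    have "distributed M lborel (\<lambda>\<omega>. W \<omega> $$ p) std_normal_density"
      using W that by (auto simp: gaussian_noise_def upper_pairs_def)
    from distributed_nn_integral[OF this, of "\<lambda>x. ennreal (exp (s * c p * x))"]
    show ?thesis using std_normal_mgf[of "s * c p"] by simp
  qed
  have "(\<integral>\<^sup>+\<omega>. ennreal (exp (s * (\<Sum>p\<in>?P. c p * W \<omega> $$ p))) \<partial>M) =
      (\<integral>\<^sup>+\<omega>. (\<Prod>p\<in>?P. ennreal (exp (s * c p * W \<omega> $$ p))) \<partial>M)"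
    by (simp add: prod_ennreal exp_sum[OF finite_upper_pairs, symmetric] sum_distrib_left mult_ac)
  also have "\<dots> = (\<Prod>p\<in>?P. \<integral>\<^sup>+\<omega>. ennreal (exp (s * c p * W \<omega> $$ p)) \<partial>M)"
    by (rule indep_vars_nn_integral[OF finite_upper_pairs])
      (auto intro!: indep_vars_compose2[OF indep, of "\<lambda>p x. ennreal (exp (s * c p * x))"])
  also have "\<dots> = (\<Prod>p\<in>?P. ennreal (exp ((s * c p)\<^sup>2 / 2)))"
    by (intro prod.cong refl one)
  also have "\<dots> = ennreal (exp (s\<^sup>2 / 2 * (\<Sum>p\<in>?P. (c p)\<^sup>2)))"
    by (simp add: prod_ennreal exp_sum[OF finite_upper_pairs, symmetric] sum_distrib_left power_mult_distrib)
  also have "\<dots> \<le> ennreal (exp (s\<^sup>2 / 2 * V))"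
    using cV by (intro ennreal_leI) (simp add: mult_left_mono)
  finally have mgf: "(\<integral>\<^sup>+\<omega>. ennreal (exp (s * (\<Sum>p\<in>?P. c p * W \<omega> $$ p))) \<partial>M) \<le> ennreal (exp (s\<^sup>2 / 2 * V))" .
  have "emeasure M {\<omega> \<in> space M. t \<le> (\<Sum>p\<in>?P. c p * W \<omega> $$ p)} \<le>
      ennreal (exp (- s * t)) *
        (\<integral>\<^sup>+\<omega>. ennreal (exp (s * (\<Sum>p\<in>?P. c p * W \<omega> $$ p))) * indicator (space M) \<omega> \<partial>M)"
    by (rule Chernoff_ineq_nn_integral_ge[OF s]) auto
  also have "(\<integral>\<^sup>+\<omega>. ennreal (exp (s * (\<Sum>p\<in>?P. c p * W \<omega> $$ p))) * indicator (space M) \<omega> \<partial>M) =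
      (\<integral>\<^sup>+\<omega>. ennreal (exp (s * (\<Sum>p\<in>?P. c p * W \<omega> $$ p))) \<partial>M)"
    by (intro nn_integral_cong) simp
  also have "ennreal (exp (- s * t)) * \<dots> \<le> ennreal (exp (- s * t)) * ennreal (exp (s\<^sup>2 / 2 * V))"
    by (intro mult_left_mono mgf) simp
  also have "\<dots> = ennreal (exp (- t\<^sup>2 / (2 * V)))"
    using V by (simp add: ennreal_mult[symmetric] exp_add[symmetric] s_def power2_eq_square field_simps)
  finally show ?thesis by (simp add: emeasure_eq_measure)
qed

section \<open>Quadratic forms controlled by lattice points\<close>

lemma quadratic_form_update:
  fixes a :: "nat \<Rightarrow> nat \<Rightarrow> real"
  assumes "m < n" "a m m = 0"
  shows "(\<Sum>i<n. \<Sum>j<n. a i j * (u(m := u m + s)) i * (u(m := u m + s)) j) =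
    (\<Sum>i<n. \<Sum>j<n. a i j * u i * u j) + s * ((\<Sum>j<n. a m j * u j) + (\<Sum>i<n. a i m * u i))"
proof -
  have d: "(u(m := u m + s)) i = u i + (if i = m then s else 0)" for i by simp
  have if1: "(\<Sum>i<n. \<Sum>j<n. a i j * (if i = m then s else 0) * u j) = s * (\<Sum>j<n. a m j * u j)"
  proof -
    have "(\<Sum>i<n. \<Sum>j<n. a i j * (if i = m then s else 0) * u j) =
        (\<Sum>i<n. if i = m then s * (\<Sum>j<n. a m j * u j) else 0)"
      by (intro sum.cong) (auto simp: sum_distrib_left mult_ac)
    then show ?thesis using assms by simp
  qed
  have if2: "(\<Sum>i<n. \<Sum>j<n. a i j * u i * (if j = m then s else 0)) = s * (\<Sum>i<n. a i m * u i)"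
    using assms by (simp add: if_distrib sum_distrib_left mult_ac cong: if_cong)
  have if3: "(\<Sum>i<n. \<Sum>j<n. a i j * (if i = m then s else 0) * (if j = m then s else 0)) = 0"
    using assms by (intro sum.neutral ballI) auto
  have "(\<Sum>i<n. \<Sum>j<n. a i j * (u(m := u m + s)) i * (u(m := u m + s)) j) =
     (\<Sum>i<n. \<Sum>j<n. a i j * u i * u j) + (\<Sum>i<n. \<Sum>j<n. a i j * (if i = m then s else 0) * u j)
     + (\<Sum>i<n. \<Sum>j<n. a i j * u i * (if j = m then s else 0))
     + (\<Sum>i<n. \<Sum>j<n. a i j * (if i = m then s else 0) * (if j = m then s else 0))"
    unfolding d sum.distrib[symmetric] by (intro sum.cong refl) (simp only: algebra_simps)
  then show ?thesis unfolding if1 if2 if3 by (simp add: algebra_simps)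
qed

text \<open>A quadratic form with zero diagonal is affine in each coordinate separately. Moving one coordinate
  after the other to the better of the two neighbouring integers therefore never decreases it.\<close>

lemma quadratic_form_rounding:
  fixes a :: "nat \<Rightarrow> nat \<Rightarrow> real" and x :: "nat \<Rightarrow> real"
  assumes "\<And>i. i < n \<Longrightarrow> a i i = 0"
  shows "\<exists>k :: nat \<Rightarrow> int. (\<forall>i<n. k i = \<lfloor>x i\<rfloor> \<or> k i = \<lfloor>x i\<rfloor> + 1) \<and>
    (\<Sum>i<n. \<Sum>j<n. a i j * x i * x j) \<le> (\<Sum>i<n. \<Sum>j<n. a i j * k i * k j)"
proof -
  have "\<exists>u. (\<forall>i<m. u i = of_int \<lfloor>x i\<rfloor> \<or> u i = of_int (\<lfloor>x i\<rfloor> + 1)) \<and> (\<forall>i\<ge>m. u i = x i) \<and>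
      (\<Sum>i<n. \<Sum>j<n. a i j * x i * x j) \<le> (\<Sum>i<n. \<Sum>j<n. a i j * u i * u j)"
    if "m \<le> n" for m
    using that
  proof (induction m)
    case 0
    show ?case by (intro exI[of _ x]) auto
  next
    case (Suc m)
    then obtain u where u: "\<forall>i<m. u i = of_int \<lfloor>x i\<rfloor> \<or> u i = of_int (\<lfloor>x i\<rfloor> + 1)" "\<forall>i\<ge>m. u i = x i"
      and le: "(\<Sum>i<n. \<Sum>j<n. a i j * x i * x j) \<le> (\<Sum>i<n. \<Sum>j<n. a i j * u i * u j)" by auto
    define b where "b = (\<Sum>j<n. a m j * u j) + (\<Sum>i<n. a i m * u i)"
    define r :: real where "r = (if b \<ge> 0 then of_int (\<lfloor>x m\<rfloor> + 1) else of_int \<lfloor>x m\<rfloor>)"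
    have "0 \<le> (r - x m) * b"
    proof (cases "b \<ge> 0")
      case True
      then have "0 \<le> r - x m" by (simp add: r_def)
      with True show ?thesis by simp
    next
      case False
      then have "r - x m \<le> 0" by (simp add: r_def)
      with False show ?thesis by (simp add: mult_nonpos_nonpos)
    qed
    moreover have "(\<Sum>i<n. \<Sum>j<n. a i j * (u(m := r)) i * (u(m := r)) j) =
        (\<Sum>i<n. \<Sum>j<n. a i j * u i * u j) + (r - x m) * b"
      using quadratic_form_update[of m n a u "r - x m"] assms[of m] Suc.prems u(2)
      by (simp add: b_def)
    ultimately have "(\<Sum>i<n. \<Sum>j<n. a i j * x i * x j) \<le>
        (\<Sum>i<n. \<Sum>j<n. a i j * (u(m := r)) i * (u(m := r)) j)"
      using le by linarith
    moreover have "\<forall>i<Suc m. (u(m := r)) i = of_int \<lfloor>x i\<rfloor> \<or> (u(m := r)) i = of_int (\<lfloor>x i\<rfloor> + 1)"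
      using u(1) by (auto simp: less_Suc_eq r_def)
    moreover have "\<forall>i\<ge>Suc m. (u(m := r)) i = x i" using u(2) by auto
    ultimately show ?case by (intro exI[of _ "u(m := r)"] conjI)
  qed
  from this[of n] obtain u where u: "\<forall>i<n. u i = of_int \<lfloor>x i\<rfloor> \<or> u i = of_int (\<lfloor>x i\<rfloor> + 1)"
    and le: "(\<Sum>i<n. \<Sum>j<n. a i j * x i * x j) \<le> (\<Sum>i<n. \<Sum>j<n. a i j * u i * u j)" by auto
  define k where "k i = \<lfloor>u i\<rfloor>" for i
  have uk: "u i = of_int (k i)" if "i < n" for i
    using u that unfolding k_def by (metis floor_of_int)
  show ?thesis
  proof (intro exI[of _ k] conjI allI impI)
    show "k i = \<lfloor>x i\<rfloor> \<or> k i = \<lfloor>x i\<rfloor> + 1" if "i < n" for i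
      using u that unfolding k_def by (metis floor_of_int)
    show "(\<Sum>i<n. \<Sum>j<n. a i j * x i * x j) \<le> (\<Sum>i<n. \<Sum>j<n. a i j * k i * k j)"
      using le uk by simp
  qed
qed

text \<open>The integer vectors with squared norm at most \<open>4 n\<close>. Values outside \<open>{..<n}\<close> are irrelevant and
  fixed by extensionality; the bound on single entries follows from the bound on the norm and only
  serves to make finiteness evident.\<close>

definition lattice_points :: "nat \<Rightarrow> (nat \<Rightarrow> int) set" where
  "lattice_points n =
     {k \<in> {..<n} \<rightarrow>\<^sub>E {- (4 * int n)..4 * int n}. (\<Sum>i<n. (k i)\<^sup>2) \<le> 4 * int n}"

lemma finite_lattice_points: "finite (lattice_points n)"
  unfolding lattice_points_def
  by (rule finite_subset[of _ "{..<n} \<rightarrow>\<^sub>E {- (4 * int n)..4 * int n}"]) (auto intro: finite_PiE)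

lemma abs_le_square_int: "\<bar>x\<bar> \<le> (x::int)\<^sup>2"
proof (cases "x = 0")
  case False
  then have "\<bar>x\<bar> * 1 \<le> \<bar>x\<bar> * \<bar>x\<bar>" by (intro mult_left_mono) auto
  then show ?thesis by (simp add: power2_eq_square abs_mult[symmetric])
qed simp

lemma sum_half_power_abs:
  "(\<Sum>y\<in>{- int m..int m}. (1 / 2 :: real) ^ nat \<bar>y\<bar>) = 3 - 2 * (1 / 2) ^ m"
proof (induction m)
  case (Suc m)
  have eq: "{- int (Suc m)..int (Suc m)} =
      insert (int (Suc m)) (insert (- int (Suc m)) {- int m..int m})" by auto
  have "(\<Sum>y\<in>{- int (Suc m)..int (Suc m)}. (1 / 2 :: real) ^ nat \<bar>y\<bar>) =
      2 * (1 / 2) ^ Suc m + (\<Sum>y\<in>{- int m..int m}. (1 / 2) ^ nat \<bar>y\<bar>)"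
    unfolding eq by (simp add: nat_add_distrib del: of_nat_Suc)
  then show ?case by (simp add: Suc)
qed simp

text \<open>A lattice point has \<open>\<ell>\<^sub>1\<close> norm at most \<open>4 n\<close>, so that \<open>16 ^ n\<close> times the product of the factors
  \<open>(1 / 2) ^ \<bar>k i\<bar>\<close> is at least \<open>1\<close>; the sum of these weights over a box factorises.\<close>

lemma card_lattice_points: "real (card (lattice_points n)) \<le> 48 ^ n"
proof -
  define B where "B = {- (4 * int n)..4 * int n}"
  have finB: "finite B" by (simp add: B_def)
  then have fin: "finite ({..<n} \<rightarrow>\<^sub>E B)" by (intro finite_PiE) auto
  have "(\<Sum>y\<in>B. (1 / 2 :: real) ^ nat \<bar>y\<bar>) = 3 - 2 * (1 / 2) ^ (4 * n)"
    using sum_half_power_abs[of "4 * n"] by (simp only: B_def of_nat_mult of_nat_numeral)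
  also have "\<dots> \<le> 3" by simp
  finally have sumB: "(\<Sum>y\<in>B. (1 / 2 :: real) ^ nat \<bar>y\<bar>) \<le> 3" .
  have ge1: "1 \<le> 16 ^ n * (\<Prod>i<n. (1 / 2 :: real) ^ nat \<bar>k i\<bar>)" if "k \<in> lattice_points n" for k
  proof -
    have "int (\<Sum>i<n. nat \<bar>k i\<bar>) = (\<Sum>i<n. \<bar>k i\<bar>)" by simp
    also have "\<dots> \<le> (\<Sum>i<n. (k i)\<^sup>2)" by (intro sum_mono abs_le_square_int)
    also have "\<dots> \<le> int (4 * n)" using that by (simp add: lattice_points_def)
    finally have "(\<Sum>i<n. nat \<bar>k i\<bar>) \<le> 4 * n" by (simp only: of_nat_le_iff)
    then have "(1 / 2 :: real) ^ (4 * n) \<le> (1 / 2) ^ (\<Sum>i<n. nat \<bar>k i\<bar>)"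
      by (intro power_decreasing) auto
    then have "16 ^ n * (1 / 2 :: real) ^ (4 * n) \<le> 16 ^ n * (1 / 2) ^ (\<Sum>i<n. nat \<bar>k i\<bar>)"
      by (intro mult_left_mono) auto
    also have "16 ^ n * (1 / 2 :: real) ^ (4 * n) = 1"
      unfolding power_mult by (subst power_mult_distrib[symmetric]) (simp add: power_divide)
    finally show ?thesis by (simp add: power_sum)
  qed
  have "real (card (lattice_points n)) = (\<Sum>k\<in>lattice_points n. 1)" by simp
  also have "\<dots> \<le> (\<Sum>k\<in>lattice_points n. 16 ^ n * (\<Prod>i<n. (1 / 2 :: real) ^ nat \<bar>k i\<bar>))"
    by (intro sum_mono ge1)
  also have "\<dots> \<le> (\<Sum>k\<in>{..<n} \<rightarrow>\<^sub>E B. 16 ^ n * (\<Prod>i<n. (1 / 2 :: real) ^ nat \<bar>k i\<bar>))"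
  proof (rule sum_mono2[OF fin])
    show "lattice_points n \<subseteq> {..<n} \<rightarrow>\<^sub>E B"
      unfolding lattice_points_def B_def by blast
    show "0 \<le> 16 ^ n * (\<Prod>i<n. (1 / 2 :: real) ^ nat \<bar>k i\<bar>)" for k
      by (intro mult_nonneg_nonneg prod_nonneg ballI zero_le_power) simp_all
  qed
  also have "\<dots> = 16 ^ n * (\<Prod>i<n. \<Sum>y\<in>B. (1 / 2 :: real) ^ nat \<bar>y\<bar>)"
    unfolding sum_distrib_left[symmetric]
    by (subst prod_sum_PiE[of "{..<n}" "\<lambda>_. B" "\<lambda>_ y. (1 / 2 :: real) ^ nat \<bar>y\<bar>"]) (rule finite_lessThan finB refl)+
  also have "\<dots> \<le> 16 ^ n * (\<Prod>i<n. 3)"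
    by (intro mult_left_mono prod_mono conjI sumB sum_nonneg) simp_all
  also have "\<dots> = 48 ^ n" unfolding prod_constant card_lessThan by (subst power_mult_distrib[symmetric]) simp
  finally show ?thesis .
qed

text \<open>Finitely many integer points control the form on all of space: a vector is scaled to squared norm
  \<open>n\<close> and rounded, which changes its entries by at most \<open>1\<close> and so keeps the squared norm within \<open>4 n\<close>.
  This replaces the usual covering argument for the largest eigenvalue.\<close>

lemma quadratic_form_le_of_lattice_points:
  fixes a :: "nat \<Rightarrow> nat \<Rightarrow> real" and v :: "nat \<Rightarrow> real"
  assumes a: "\<And>i. i < n \<Longrightarrow> a i i = 0"
    and T: "\<And>k. k \<in> lattice_points n \<Longrightarrow> (\<Sum>i<n. \<Sum>j<n. a i j * k i * k j) \<le> T"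
  shows "(\<Sum>i<n. \<Sum>j<n. a i j * v i * v j) \<le> T / n * (\<Sum>i<n. (v i)\<^sup>2)"
proof (cases "(\<Sum>i<n. (v i)\<^sup>2) = 0")
  case True
  then have "\<forall>i<n. v i = 0" by (simp add: sum_nonneg_eq_0_iff)
  then show ?thesis by simp
next
  case False
  define N where "N = (\<Sum>i<n. (v i)\<^sup>2)"
  have N: "N > 0" using False sum_nonneg[of "{..<n}" "\<lambda>i. (v i)\<^sup>2"] by (simp add: N_def order_less_le)
  have n: "n > 0" using False by (cases n) auto
  define \<alpha> where "\<alpha> = sqrt (n / N)"
  have \<alpha>: "\<alpha>\<^sup>2 = n / N" using N by (simp add: \<alpha>_def)
  define x where "x i = \<alpha> * v i" for i
  have x2: "(\<Sum>i<n. (x i)\<^sup>2) = n"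
    unfolding x_def power_mult_distrib sum_distrib_left[symmetric] \<alpha> N_def[symmetric] using N by simp
  from quadratic_form_rounding[of n a x, OF a] obtain k :: "nat \<Rightarrow> int" where
    k: "\<forall>i<n. k i = \<lfloor>x i\<rfloor> \<or> k i = \<lfloor>x i\<rfloor> + 1"
    and le: "(\<Sum>i<n. \<Sum>j<n. a i j * x i * x j) \<le> (\<Sum>i<n. \<Sum>j<n. a i j * k i * k j)" by blast
  define k' where "k' = restrict k {..<n}"
  have sq: "(\<Sum>i<n. (k i)\<^sup>2) \<le> 4 * int n"
  proof -
    have "real_of_int (\<Sum>i<n. (k i)\<^sup>2) \<le> (\<Sum>i<n. 2 * (x i)\<^sup>2 + 2)"
      unfolding of_int_sum
    proof (intro sum_mono)
      fix i assume "i \<in> {..<n}"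
      then have "k i = \<lfloor>x i\<rfloor> \<or> k i = \<lfloor>x i\<rfloor> + 1" using k by simp
      then have "\<bar>real_of_int (k i)\<bar> \<le> \<bar>x i\<bar> + 1" by linarith
      then have "\<bar>real_of_int (k i)\<bar>\<^sup>2 \<le> (\<bar>x i\<bar> + 1)\<^sup>2"
        by (intro power_mono) auto
      then have "(real_of_int (k i))\<^sup>2 \<le> (\<bar>x i\<bar> + 1)\<^sup>2" by simp
      also have "\<dots> \<le> 2 * (x i)\<^sup>2 + 2"
        using sum_squares_bound[of "\<bar>x i\<bar>" 1] by (simp add: power2_sum)
      finally show "real_of_int ((k i)\<^sup>2) \<le> 2 * (x i)\<^sup>2 + 2" by simp
    qed
    also have "\<dots> = real_of_int (4 * int n)"
      by (simp add: sum.distrib sum_distrib_left[symmetric] x2)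
    finally show ?thesis by (simp only: of_int_le_iff)
  qed
  have "k i \<in> {- (4 * int n)..4 * int n}" if "i < n" for i
  proof -
    have "\<bar>k i\<bar> \<le> (k i)\<^sup>2" by (rule abs_le_square_int)
    also have "\<dots> \<le> (\<Sum>i<n. (k i)\<^sup>2)" using that by (intro member_le_sum) auto
    finally show ?thesis using sq by auto
  qed
  then have "k' \<in> lattice_points n" using sq by (auto simp: lattice_points_def k'_def)
  from T[OF this] le have "(\<Sum>i<n. \<Sum>j<n. a i j * x i * x j) \<le> T" by (simp add: k'_def)
  also have "(\<Sum>i<n. \<Sum>j<n. a i j * x i * x j) = \<alpha>\<^sup>2 * (\<Sum>i<n. \<Sum>j<n. a i j * v i * v j)"
    unfolding sum_distrib_left by (intro sum.cong refl) (simp add: x_def power2_eq_square)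
  finally show ?thesis unfolding \<alpha> N_def[symmetric] using N n by (simp add: field_simps)
qed

section \<open>High-probability bounds on the noise\<close>

text \<open>The quantity \<open>z\<^sub>i (W z)\<^sub>i\<close> is a sum of \<open>n - 1\<close> independent standard normal variables up to sign. The
  factor \<open>1 / (2 n)\<close> in the exponent is sharp to leading order, which is what makes the threshold
  constant \<open>2 + \<epsilon>\<close> attainable.\<close>

lemma gaussian_noise_row_tail:
  assumes W: "gaussian_noise n M W" and z: "z \<in> sign_vecs n" and i: "i < n" and s: "s > 0"
  shows "\<exists>B\<in>sets M. measure M B \<le> exp (- s\<^sup>2 / (2 * real n)) \<and>
    (\<forall>\<omega>\<in>space M - B. - s < z $ i * (W \<omega> *\<^sub>v z) $ i)"
proof -
  define c where "c = (\<lambda>(a, b). if a = i \<or> b = i then - (z $ a * z $ b) else 0)"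
  define B where "B = {\<omega> \<in> space M. s \<le> (\<Sum>p\<in>upper_pairs n. c p * W \<omega> $$ p)}"
  have z': "z \<in> carrier_vec n" using z by (simp add: sign_vecs_def)
  have [measurable]: "(\<lambda>\<omega>. W \<omega> $$ p) \<in> borel_measurable M" if "p \<in> upper_pairs n" for p
    by (rule gaussian_noise_measurable[OF W that])
  have "B \<in> sets M" unfolding B_def by measurable
  moreover have "measure M B \<le> exp (- s\<^sup>2 / (2 * real n))"
    unfolding B_def
  proof (rule gaussian_noise_tail[OF W s])
    have "(\<Sum>p\<in>upper_pairs n. (c p)\<^sup>2) =
        (\<Sum>(a, b)\<in>upper_pairs n. (if a = i \<and> b \<noteq> i then 1 else 0) + (if b = i \<and> a \<noteq> i then 1 else 0))"
      using sign_vecs_square[OF z]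
      by (intro sum.cong) (auto simp: upper_pairs_def c_def power2_eq_square algebra_simps)
    also have "\<dots> = (\<Sum>a<n. \<Sum>b<n. (if a = i \<and> b \<noteq> i then 1 else 0))"
      by (rule sum_sum_upper_pairs[symmetric]) auto
    also have "\<dots> \<le> (\<Sum>a<n. \<Sum>b<n. (if a = i then 1 else 0))"
      by (intro sum_mono) auto
    also have "\<dots> = (\<Sum>a<n. if a = i then real n else 0)"
      by (intro sum.cong) auto
    also have "\<dots> = n" using i by simp
    finally show "(\<Sum>p\<in>upper_pairs n. (c p)\<^sup>2) \<le> real n" .
  qed (use i in auto)
  moreover have "- s < z $ i * (W \<omega> *\<^sub>v z) $ i" if "\<omega> \<in> space M - B" for \<omega>
  proof -
    have S: "W \<omega> \<in> sym_mats n" "\<And>j. j < n \<Longrightarrow> W \<omega> $$ (j, j) = 0"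
      using W that by (auto simp: gaussian_noise_def)
    then have Wc: "W \<omega> \<in> carrier_mat n n" by (simp add: sym_mats_def)
    have sym: "W \<omega> $$ (a, b) = W \<omega> $$ (b, a)" if "a < n" "b < n" for a b
      by (rule sym_mats_entry[OF S(1) that])
    have "(\<Sum>p\<in>upper_pairs n. c p * W \<omega> $$ p) =
        (\<Sum>(a, b)\<in>upper_pairs n. (if a = i then - (z $ a * z $ b * W \<omega> $$ (a, b)) else 0) +
           (if b = i then - (z $ b * z $ a * W \<omega> $$ (b, a)) else 0))"
      by (intro sum.cong) (auto simp: upper_pairs_def c_def sym)
    also have "\<dots> = (\<Sum>a<n. \<Sum>b<n. if a = i then - (z $ a * z $ b * W \<omega> $$ (a, b)) else 0)"
      by (rule sum_sum_upper_pairs[symmetric]) (simp add: S)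
    also have "\<dots> = (\<Sum>a<n. if a = i then - (\<Sum>b<n. z $ i * z $ b * W \<omega> $$ (i, b)) else 0)"
      by (intro sum.cong) (auto simp: sum_negf)
    also have "\<dots> = - (\<Sum>b<n. z $ i * z $ b * W \<omega> $$ (i, b))" using i by simp
    also have "\<dots> = - (z $ i * (W \<omega> *\<^sub>v z) $ i)"
      using Wc z' i by (simp add: scalar_prod_def lessThan_atLeast0 sum_distrib_left mult_ac)
    finally show ?thesis using that by (auto simp: B_def)
  qed
  ultimately show ?thesis by blast
qed

text \<open>Summed over the off-diagonal pairs, the variance is at most \<open>2 (4 n)\<^sup>2 = 32 n\<^sup>2\<close>. The threshold is
  chosen so that the tail \<open>exp (- 16 n)\<close> beats the number \<open>48 ^ n\<close> of lattice points.\<close>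

lemma gaussian_noise_lattice_point_tail:
  fixes k :: "nat \<Rightarrow> int"
  assumes W: "gaussian_noise n M W" and n: "n > 0" and k: "k \<in> lattice_points n"
  shows "\<exists>B\<in>sets M. measure M B \<le> exp (- 16 * real n) \<and>
    (\<forall>\<omega>\<in>space M - B. (\<Sum>i<n. \<Sum>j<n. W \<omega> $$ (i, j) * k i * k j) \<le> 32 * real n * sqrt n)"
proof -
  define c where "c = (\<lambda>(a, b). 2 * real_of_int (k a) * real_of_int (k b))"
  define t where "t = 32 * real n * sqrt n"
  define B where "B = {\<omega> \<in> space M. t \<le> (\<Sum>p\<in>upper_pairs n. c p * W \<omega> $$ p)}"
  have [measurable]: "(\<lambda>\<omega>. W \<omega> $$ p) \<in> borel_measurable M" if "p \<in> upper_pairs n" for p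
    by (rule gaussian_noise_measurable[OF W that])
  have "B \<in> sets M" unfolding B_def by measurable
  moreover have "measure M B \<le> exp (- t\<^sup>2 / (2 * (32 * (real n)\<^sup>2)))"
    unfolding B_def
  proof (rule gaussian_noise_tail[OF W])
    define q where "q a = (real_of_int (k a))\<^sup>2" for a
    have q: "0 \<le> q a" for a by (simp add: q_def)
    have "(\<Sum>p\<in>upper_pairs n. (c p)\<^sup>2) =
        (\<Sum>(a, b)\<in>upper_pairs n. (if a = b then 0 else 2 * q a * q b) + (if b = a then 0 else 2 * q b * q a))"
      by (intro sum.cong) (auto simp: upper_pairs_def c_def q_def power_mult_distrib)
    also have "\<dots> = (\<Sum>a<n. \<Sum>b<n. if a = b then 0 else 2 * q a * q b)"
      by (rule sum_sum_upper_pairs[symmetric]) simp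
    also have "\<dots> \<le> (\<Sum>a<n. \<Sum>b<n. 2 * q a * q b)"
      using q by (intro sum_mono) auto
    also have "\<dots> = 2 * (\<Sum>a<n. q a)\<^sup>2"
      by (simp add: power2_eq_square sum_product sum_distrib_left mult_ac)
    also have "(\<Sum>a<n. q a) \<le> 4 * n"
    proof -
      have "(\<Sum>a<n. q a) = real_of_int (\<Sum>a<n. (k a)\<^sup>2)" by (simp add: q_def)
      also have "\<dots> \<le> real_of_int (4 * int n)"
        using k unfolding of_int_le_iff by (simp add: lattice_points_def)
      finally show ?thesis by simp
    qed
    then have "2 * (\<Sum>a<n. q a)\<^sup>2 \<le> 2 * (4 * real n)\<^sup>2"
      using q by (intro mult_left_mono power_mono sum_nonneg) auto
    finally show "(\<Sum>p\<in>upper_pairs n. (c p)\<^sup>2) \<le> 32 * (real n)\<^sup>2" by (simp add: power_mult_distrib)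
  qed (use n in \<open>auto simp: t_def\<close>)
  moreover have "- t\<^sup>2 / (2 * (32 * (real n)\<^sup>2)) = - 16 * real n"
    using n by (simp add: t_def power_mult_distrib)
  moreover have "(\<Sum>i<n. \<Sum>j<n. W \<omega> $$ (i, j) * k i * k j) \<le> t" if "\<omega> \<in> space M - B" for \<omega>
  proof -
    have S: "W \<omega> \<in> sym_mats n" "\<And>j. j < n \<Longrightarrow> W \<omega> $$ (j, j) = 0"
      using W that by (auto simp: gaussian_noise_def)
    have sym: "W \<omega> $$ (a, b) = W \<omega> $$ (b, a)" if "a < n" "b < n" for a b
      by (rule sym_mats_entry[OF S(1) that])
    have "(\<Sum>i<n. \<Sum>j<n. W \<omega> $$ (i, j) * k i * k j) =
        (\<Sum>(i, j)\<in>upper_pairs n. W \<omega> $$ (i, j) * k i * k j + W \<omega> $$ (j, i) * k j * k i)"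
      by (rule sum_sum_upper_pairs) (simp add: S)
    also have "\<dots> = (\<Sum>p\<in>upper_pairs n. c p * W \<omega> $$ p)"
      by (intro sum.cong) (auto simp: upper_pairs_def c_def sym)
    finally show ?thesis using that by (auto simp: B_def)
  qed
  ultimately show ?thesis unfolding t_def by (intro bexI[of _ B]) auto
qed

lemma (in prob_space) union_bound_events:
  assumes "finite I"
    and "\<And>i. i \<in> I \<Longrightarrow> \<exists>B\<in>sets M. measure M B \<le> p \<and> (\<forall>\<omega>\<in>space M - B. Q i \<omega>)"
  shows "\<exists>B\<in>sets M. measure M B \<le> real (card I) * p \<and> (\<forall>\<omega>\<in>space M - B. \<forall>i\<in>I. Q i \<omega>)"
proof -
  obtain A where A: "\<And>i. i \<in> I \<Longrightarrow> A i \<in> sets M" "\<And>i. i \<in> I \<Longrightarrow> measure M (A i) \<le> p"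
    "\<And>i \<omega>. i \<in> I \<Longrightarrow> \<omega> \<in> space M - A i \<Longrightarrow> Q i \<omega>"
    using assms(2) by metis
  have "measure M (\<Union>i\<in>I. A i) \<le> (\<Sum>i\<in>I. measure M (A i))"
    using A(1) assms(1) by (intro finite_measure_subadditive_finite) auto
  also have "\<dots> \<le> real (card I) * p" using A(2) by (rule sum_bounded_above)
  finally show ?thesis
    using A assms(1) by (intro bexI[of _ "\<Union>i\<in>I. A i"]) auto
qed

lemma gaussian_noise_bounds:
  assumes W: "gaussian_noise n M W" and z: "z \<in> sign_vecs n" and n: "n > 0" and s: "s > 0"
  shows "\<exists>E\<in>sets M. 1 - real n * exp (- s\<^sup>2 / (2 * real n)) - (1 / 2) ^ n \<le> measure M E \<and>
    (\<forall>\<omega>\<in>E. W \<omega> \<in> sym_mats n \<and> (\<forall>i<n. - s < z $ i * (W \<omega> *\<^sub>v z) $ i) \<and>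
      (\<forall>v\<in>carrier_vec n. v \<bullet> (W \<omega> *\<^sub>v v) \<le> 32 * sqrt n * (v \<bullet> v)))"
proof -
  interpret prob_space M using W by (simp add: gaussian_noise_def)
  obtain A where A: "A \<in> sets M" "measure M A \<le> real n * exp (- s\<^sup>2 / (2 * real n))"
    and AQ: "\<And>\<omega> i. \<omega> \<in> space M - A \<Longrightarrow> i < n \<Longrightarrow> - s < z $ i * (W \<omega> *\<^sub>v z) $ i"
    using union_bound_events[of "{..<n}" _ "\<lambda>i \<omega>. - s < z $ i * (W \<omega> *\<^sub>v z) $ i",
        OF _ gaussian_noise_row_tail[OF W z _ s]] by auto
  have "\<exists>B\<in>sets M. measure M B \<le> real (card (lattice_points n)) * exp (- 16 * real n) \<and>
      (\<forall>\<omega>\<in>space M - B. \<forall>k\<in>lattice_points n.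
        (\<Sum>i<n. \<Sum>j<n. W \<omega> $$ (i, j) * k i * k j) \<le> 32 * real n * sqrt n)"
    by (rule union_bound_events[OF finite_lattice_points gaussian_noise_lattice_point_tail[OF W n]])
  then obtain B where B: "B \<in> sets M"
      "measure M B \<le> real (card (lattice_points n)) * exp (- 16 * real n)"
    and BQ: "\<And>\<omega> k. \<omega> \<in> space M - B \<Longrightarrow> k \<in> lattice_points n \<Longrightarrow>
      (\<Sum>i<n. \<Sum>j<n. W \<omega> $$ (i, j) * k i * k j) \<le> 32 * real n * sqrt n"
    by blast
  note B(2)
  also have "real (card (lattice_points n)) * exp (- 16 * real n) \<le> 48 ^ n * exp (- 16 * real n)"
    by (intro mult_right_mono card_lattice_points) simp
  also have "exp (- 16 * real n) = exp (- 16) ^ n"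
    by (simp add: exp_of_nat_mult[symmetric] mult.commute)
  also have "48 ^ n * exp (- 16) ^ n = (48 * exp (- 16 :: real)) ^ n"
    by (rule power_mult_distrib[symmetric])
  also have "\<dots> \<le> (1 / 2) ^ n"
  proof (rule power_mono)
    have "(2 :: real) ^ 16 \<le> exp 1 ^ 16"
      using exp_ge_add_one_self[of "1 :: real"] by (intro power_mono) auto
    also have "\<dots> = exp 16" by (simp add: exp_of_nat_mult[symmetric])
    finally have "(96 :: real) \<le> exp 16" by simp
    then show "48 * exp (- 16 :: real) \<le> 1 / 2" by (simp add: exp_minus field_simps)
  qed simp
  finally have mB: "measure M B \<le> (1 / 2) ^ n" .
  define bad where "bad = A \<union> B"
  have bad: "bad \<in> sets M" using A(1) B(1) by (simp add: bad_def)
  have "measure M bad \<le> real n * exp (- s\<^sup>2 / (2 * real n)) + (1 / 2) ^ n"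
    using measure_Un_le[OF A(1) B(1)] A(2) mB unfolding bad_def by linarith
  then have "1 - real n * exp (- s\<^sup>2 / (2 * real n)) - (1 / 2) ^ n \<le> measure M (space M - bad)"
    using prob_compl[OF bad] by linarith
  moreover have "space M - bad \<in> sets M" using bad by auto
  moreover have "W \<omega> \<in> sym_mats n \<and> (\<forall>i<n. - s < z $ i * (W \<omega> *\<^sub>v z) $ i) \<and>
      (\<forall>v\<in>carrier_vec n. v \<bullet> (W \<omega> *\<^sub>v v) \<le> 32 * sqrt n * (v \<bullet> v))"
    if \<omega>: "\<omega> \<in> space M - bad" for \<omega>
  proof (intro conjI allI impI ballI)
    show S: "W \<omega> \<in> sym_mats n" using W \<omega> by (simp add: gaussian_noise_def)
    show "- s < z $ i * (W \<omega> *\<^sub>v z) $ i" if "i < n" for i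
      using AQ[OF _ that] \<omega> by (auto simp: bad_def)
    fix v :: "real vec" assume v: "v \<in> carrier_vec n"
    have Wc: "W \<omega> \<in> carrier_mat n n" using S by (simp add: sym_mats_def)
    have "v \<bullet> (W \<omega> *\<^sub>v v) = (\<Sum>i<n. \<Sum>j<n. W \<omega> $$ (i, j) * v $ i * v $ j)"
      by (rule scalar_prod_mult_mat_vec_sum[OF Wc v v])
    also have "\<dots> \<le> (32 * real n * sqrt n) / n * (\<Sum>i<n. (v $ i)\<^sup>2)"
    proof (rule quadratic_form_le_of_lattice_points)
      show "W \<omega> $$ (i, i) = 0" if "i < n" for i
        using W \<omega> that by (simp add: gaussian_noise_def)
      show "(\<Sum>i<n. \<Sum>j<n. W \<omega> $$ (i, j) * k i * k j) \<le> 32 * real n * sqrt n"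
        if "k \<in> lattice_points n" for k
        using BQ[OF _ that] \<omega> by (auto simp: bad_def)
    qed
    also have "(\<Sum>i<n. (v $ i)\<^sup>2) = v \<bullet> v"
      using v by (simp add: scalar_prod_def power2_eq_square lessThan_atLeast0)
    finally show "v \<bullet> (W \<omega> *\<^sub>v v) \<le> 32 * sqrt n * (v \<bullet> v)" using n by simp
  qed
  ultimately show ?thesis by blast
qed

text \<open>On the orthogonal complement of \<open>z\<close> the rank-one part of \<open>Y\<close> drops out, and the quadratic form of
  the slack matrix is that of the diagonal matrix with entries \<open>n + \<gamma> z\<^sub>i (W z)\<^sub>i\<close> minus \<open>\<gamma> W\<close>.\<close>

lemma certificate_coercive:
  fixes W :: "real mat"
  assumes W: "W \<in> sym_mats n" and z: "z \<in> sign_vecs n" and \<gamma>: "0 \<le> \<gamma>"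
    and row: "\<And>i. i < n \<Longrightarrow> - s \<le> z $ i * (W *\<^sub>v z) $ i"
    and quad: "\<And>v. v \<in> carrier_vec n \<Longrightarrow> v \<bullet> (W *\<^sub>v v) \<le> \<kappa> * (v \<bullet> v)"
    and v: "v \<in> carrier_vec n" "z \<bullet> v = 0"
  defines "Y \<equiv> outer z + \<gamma> \<cdot>\<^sub>m W"
  shows "(n - \<gamma> * s - \<gamma> * \<kappa>) * (v \<bullet> v) \<le> v \<bullet> ((- Y - Diag (dual_certificate n Y z)) *\<^sub>v v)"
proof -
  have W': "W \<in> carrier_mat n n" using W by (simp add: sym_mats_def)
  have z': "z \<in> carrier_vec n" using z by (simp add: sign_vecs_def)
  have O: "outer z \<in> carrier_mat n n" using z' by (simp add: outer_def)
  have Y: "Y \<in> carrier_mat n n" using W' O by (simp add: Y_def)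
  have Yv: "Y *\<^sub>v u = (z \<bullet> u) \<cdot>\<^sub>v z + \<gamma> \<cdot>\<^sub>v (W *\<^sub>v u)" if "u \<in> carrier_vec n" for u
  proof -
    have "(\<gamma> \<cdot>\<^sub>m W) *\<^sub>v u = \<gamma> \<cdot>\<^sub>v (W *\<^sub>v u)" using that W' by (intro eq_vecI) auto
    then show ?thesis
      using that W' O z' unfolding Y_def
      by (simp add: add_mult_distrib_mat_vec[of _ n n] outer_mult_vec)
  qed
  define y where "y = dual_certificate n Y z"
  have y: "y \<in> carrier_vec n" by (simp add: y_def dual_certificate_def)
  have zz: "z \<bullet> z = n"
    using z' sign_vecs_square[OF z] by (simp add: scalar_prod_def lessThan_atLeast0)
  have yi: "y $ i \<le> - (n - \<gamma> * s)" if "i < n" for i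
  proof -
    have "(Y *\<^sub>v z) $ i = n * z $ i + \<gamma> * (W *\<^sub>v z) $ i"
      using that z' W' by (simp add: Yv zz)
    then have "y $ i = - (n * (z $ i * z $ i)) - \<gamma> * (z $ i * (W *\<^sub>v z) $ i)"
      using that by (simp add: y_def dual_certificate_def algebra_simps)
    also have "\<dots> \<le> - n - \<gamma> * (- s)"
      using mult_left_mono[OF row[OF that] \<gamma>] sign_vecs_square[OF z that] by simp
    finally show ?thesis by simp
  qed
  have "v \<bullet> (Y *\<^sub>v v) = \<gamma> * (v \<bullet> (W *\<^sub>v v))"
    using v W' z' by (simp add: Yv scalar_prod_add_distrib[of _ n])
  also have "\<dots> \<le> \<gamma> * (\<kappa> * (v \<bullet> v))" using \<gamma> quad[OF v(1)] by (intro mult_left_mono)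
  finally have 1: "v \<bullet> (Y *\<^sub>v v) \<le> \<gamma> * \<kappa> * (v \<bullet> v)" by simp
  have vv: "v \<bullet> v = (\<Sum>i<n. (v $ i)\<^sup>2)"
    using v by (simp add: scalar_prod_def power2_eq_square lessThan_atLeast0)
  have D: "Diag y \<in> carrier_mat n n" using y by (simp add: Diag_def mat_diag_def)
  have "v \<bullet> (Diag y *\<^sub>v v) = (\<Sum>i<n. \<Sum>j<n. if j = i then y $ i * (v $ i)\<^sup>2 else 0)"
    unfolding scalar_prod_mult_mat_vec_sum[OF D v(1) v(1)] using y
    by (intro sum.cong refl) (auto simp: Diag_def mat_diag_def power2_eq_square)
  also have "\<dots> = (\<Sum>i<n. y $ i * (v $ i)\<^sup>2)" by simp
  also have "\<dots> \<le> (\<Sum>i<n. - (n - \<gamma> * s) * (v $ i)\<^sup>2)"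
    using yi by (intro sum_mono mult_right_mono) auto
  also have "\<dots> = - (n - \<gamma> * s) * (v \<bullet> v)" unfolding vv by (rule sum_distrib_left[symmetric])
  finally have 2: "v \<bullet> (Diag y *\<^sub>v v) \<le> - (n - \<gamma> * s) * (v \<bullet> v)" .
  have "v \<bullet> ((- Y - Diag y) *\<^sub>v v) = - (v \<bullet> (Y *\<^sub>v v)) - v \<bullet> (Diag y *\<^sub>v v)"
    using Y D v by (simp add: minus_mult_distrib_mat_vec[of _ n n] scalar_prod_minus_distrib[of _ n])
  with 1 2 show ?thesis by (simp add: y_def algebra_simps)
qed

section \<open>Exact recovery below the noise threshold\<close>

text \<open>The diagonal fluctuation costs a fraction \<open>r < 1\<close> of the signal \<open>n\<close>, because \<open>\<epsilon> / 2 < \<epsilon>\<close>; the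
  spectral norm of the noise costs a fraction that tends to zero, as \<open>\<gamma> sqrt n\<close> is at most of order
  \<open>n / sqrt (ln n)\<close>.\<close>

lemma dual_certificate_gap:
  fixes r :: real and n :: nat
  assumes n: "2 \<le> n" and \<epsilon>: "0 < \<epsilon>" and r: "r = sqrt ((2 + \<epsilon> / 2) / (2 + \<epsilon>))"
    and \<gamma>: "0 \<le> \<gamma>" "\<gamma> < sqrt (n / ((2 + \<epsilon>) * ln n))"
    and large: "32 / sqrt ((2 + \<epsilon>) * ln n) \<le> (1 - r) / 4"
  shows "3 / 4 * (1 - r) * n \<le> n - \<gamma> * sqrt ((2 + \<epsilon> / 2) * n * ln n) - \<gamma> * (32 * sqrt n)"
proof -
  define L where "L = (2 + \<epsilon>) * ln (real n)"
  have L: "L > 0" using n \<epsilon> by (simp add: L_def)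
  have "\<gamma> * sqrt ((2 + \<epsilon> / 2) * n * ln n) \<le> sqrt (n / L) * sqrt ((2 + \<epsilon> / 2) * n * ln n)"
    using \<gamma> n \<epsilon> by (intro mult_right_mono) (auto simp: L_def)
  also have "\<dots> = sqrt ((real n)\<^sup>2 * ((2 + \<epsilon> / 2) / (2 + \<epsilon>)))"
    unfolding real_sqrt_mult[symmetric] using n \<epsilon> by (simp add: L_def power2_eq_square)
  also have "\<dots> = n * r" unfolding real_sqrt_mult r by simp
  finally have 1: "\<gamma> * sqrt ((2 + \<epsilon> / 2) * n * ln n) \<le> n * r" .
  have "\<gamma> * (32 * sqrt n) \<le> sqrt (n / L) * (32 * sqrt n)"
    using \<gamma> by (intro mult_right_mono) (auto simp: L_def)
  also have "\<dots> = n * (32 / sqrt L)" by (simp add: real_sqrt_divide)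
  also have "\<dots> \<le> n * ((1 - r) / 4)" using large by (intro mult_left_mono) (auto simp: L_def)
  finally have 2: "\<gamma> * (32 * sqrt n) \<le> n * ((1 - r) / 4)" .
  have "3 / 4 * (1 - r) * n = n - n * r - n * ((1 - r) / 4)" by (simp add: field_simps)
  with 1 2 show ?thesis by linarith
qed

lemma noise_probability_bound_tendsto:
  fixes \<epsilon> :: real
  assumes "0 < \<epsilon>"
  shows "(\<lambda>n. 1 - real n * exp (- (sqrt ((2 + \<epsilon> / 2) * n * ln n))\<^sup>2 / (2 * real n)) - (1 / 2) ^ n)
    \<longlonglongrightarrow> 1"
proof -
  have "(\<lambda>n. 1 - real n powr (- \<epsilon> / 4) - (1 / 2) ^ n) \<longlonglongrightarrow> 1"
    using assms by real_asymp
  moreover have "\<forall>\<^sub>F n in sequentially. 1 - real n powr (- \<epsilon> / 4) - (1 / 2) ^ n =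
      1 - real n * exp (- (sqrt ((2 + \<epsilon> / 2) * n * ln n))\<^sup>2 / (2 * real n)) - (1 / 2) ^ n"
    using eventually_ge_at_top[of 1]
  proof eventually_elim
    case (elim n)
    have "- (sqrt ((2 + \<epsilon> / 2) * n * ln n))\<^sup>2 / (2 * real n) = - \<epsilon> / 4 * ln n - ln n"
      using elim assms by (simp add: field_simps)
    then have "real n * exp (- (sqrt ((2 + \<epsilon> / 2) * n * ln n))\<^sup>2 / (2 * real n)) = real n powr (- \<epsilon> / 4)"
      using elim by (simp add: exp_diff powr_def)
    then show ?case by simp
  qed
  ultimately show ?thesis by (rule Lim_transform_eventually)
qed

theorem theorem4p1:
  fixes \<epsilon> :: real
  assumes "\<epsilon> > 0"
  shows "\<exists>c::real. 0 < c \<and> c < 1 \<and>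
    (\<forall>(M :: nat \<Rightarrow> 'a measure) (W :: nat \<Rightarrow> 'a \<Rightarrow> real mat) (z :: nat \<Rightarrow> real vec) (\<gamma> :: nat \<Rightarrow> real).
      (\<forall>n. gaussian_noise n (M n) (W n)) \<longrightarrow>
      (\<forall>n. z n \<in> sign_vecs n) \<longrightarrow>
      (\<forall>n. 0 \<le> \<gamma> n) \<longrightarrow>
      (\<forall>n\<ge>2. \<gamma> n < sqrt (real n / ((2 + \<epsilon>) * ln (real n)))) \<longrightarrow>
      whp M (\<lambda>n \<omega>.
        let Y = outer (z n) + \<gamma> n \<cdot>\<^sub>m W n \<omega> in
          simple_sdp (diag_sdp Y) \<and>
          primal_solution (diag_sdp Y) (outer (z n)) \<and>
          (\<forall>y. dual_solution (diag_sdp Y) y \<longrightarrow> eig (n - 1) (- Y - Diag y) > c * real n)))"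
proof -
  define r where "r = sqrt ((2 + \<epsilon> / 2) / (2 + \<epsilon>))"
  have r: "0 < r" "r < 1" using assms by (auto simp: r_def)
  have "(\<lambda>n. 32 / sqrt ((2 + \<epsilon>) * ln (real n))) \<longlonglongrightarrow> 0"
    using assms by real_asymp
  then have "\<forall>\<^sub>F n in sequentially. 32 / sqrt ((2 + \<epsilon>) * ln (real n)) < (1 - r) / 4"
    using r by (intro order_tendstoD(2)) auto
  then obtain N where N: "\<And>n. n \<ge> N \<Longrightarrow> 32 / sqrt ((2 + \<epsilon>) * ln (real n)) < (1 - r) / 4"
    unfolding eventually_sequentially by blast
  \<comment> \<open>Any constant below \<open>3 / 4 * (1 - r)\<close> would do; a smaller one gives the strict inequality.\<close>
  define c where "c = (1 - r) / 2"
  have c: "0 < c" "c < 1" using r by (auto simp: c_def)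
  show ?thesis
  proof (intro exI[of _ c] conjI c allI impI)
    fix M :: "nat \<Rightarrow> 'a measure" and W z \<gamma>
    assume W: "\<forall>n. gaussian_noise n (M n) (W n)" and z: "\<forall>n. z n \<in> sign_vecs n"
      and \<gamma>: "\<forall>n. 0 \<le> \<gamma> n" "\<forall>n\<ge>2. \<gamma> n < sqrt (real n / ((2 + \<epsilon>) * ln (real n)))"
    define Q where "Q n \<omega> \<longleftrightarrow> (let Y = outer (z n) + \<gamma> n \<cdot>\<^sub>m W n \<omega> in
          simple_sdp (diag_sdp Y) \<and>
          primal_solution (diag_sdp Y) (outer (z n)) \<and>
          (\<forall>y. dual_solution (diag_sdp Y) y \<longrightarrow> eig (n - 1) (- Y - Diag y) > c * real n))" for n \<omega>
    \<comment> \<open>Slightly above the typical size \<open>sqrt (2 n ln n)\<close> of the largest row fluctuation.\<close>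
    define s where "s n = sqrt ((2 + \<epsilon> / 2) * n * ln n)" for n :: nat
    define f where "f n = 1 - real n * exp (- (s n)\<^sup>2 / (2 * real n)) - (1 / 2) ^ n" for n
    have "\<exists>E. E \<in> sets (M n) \<and> (\<forall>\<omega>\<in>E. Q n \<omega>) \<and> (max 2 N \<le> n \<longrightarrow> f n \<le> measure (M n) E)" for n
    proof (cases "max 2 N \<le> n")
      case False
      \<comment> \<open>Small dimensions do not affect the limit, and the empty event suffices.\<close>
      then show ?thesis by (intro exI[of _ "{}"]) auto
    next
      case True
      then have n: "2 \<le> n" "N \<le> n" by auto
      have s: "s n > 0" using n assms by (simp add: s_def)
      define \<kappa> where "\<kappa> = n - \<gamma> n * s n - \<gamma> n * (32 * sqrt n)"
      have \<kappa>: "3 / 4 * (1 - r) * n \<le> \<kappa>"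
        unfolding \<kappa>_def s_def using \<gamma> n
        by (intro dual_certificate_gap[OF n(1) assms r_def] less_imp_le[OF N]) auto
      moreover have "c * n < 3 / 4 * (1 - r) * n"
        using r n by (intro mult_strict_right_mono) (auto simp: c_def)
      ultimately have \<kappa>c: "c * n < \<kappa>" by linarith
      then have \<kappa>0: "0 < \<kappa>" using c n by (meson le_less_trans less_imp_le mult_nonneg_nonneg of_nat_0_le_iff)
      obtain E where E: "E \<in> sets (M n)" "f n \<le> measure (M n) E"
        and Eb: "\<And>\<omega>. \<omega> \<in> E \<Longrightarrow> W n \<omega> \<in> sym_mats n \<and> (\<forall>i<n. - s n < z n $ i * (W n \<omega> *\<^sub>v z n) $ i) \<and>
          (\<forall>v\<in>carrier_vec n. v \<bullet> (W n \<omega> *\<^sub>v v) \<le> 32 * sqrt n * (v \<bullet> v))"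
        using gaussian_noise_bounds[OF W[rule_format, of n] z[rule_format] _ s] n unfolding f_def by auto
      have "Q n \<omega>" if "\<omega> \<in> E" for \<omega>
      proof -
        define Y where "Y = outer (z n) + \<gamma> n \<cdot>\<^sub>m W n \<omega>"
        have S: "W n \<omega> \<in> sym_mats n" using Eb[OF that] by simp
        have z': "z n \<in> carrier_vec n" using z by (simp add: sign_vecs_def)
        have Y: "Y \<in> sym_mats n"
          using S z' by (auto simp: Y_def sym_mats_def outer_def sym_mats_entry[OF S] intro!: eq_matI)
        have "simple_sdp (diag_sdp Y) \<and> primal_solution (diag_sdp Y) (outer (z n)) \<and>
          (\<forall>y. dual_solution (diag_sdp Y) y \<longrightarrow> \<kappa> \<le> eig (n - 1) (- Y - Diag y))"
        proof (rule diag_sdp_simple_of_coercive[OF Y z[rule_format] n(1) \<kappa>0])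
          fix v :: "real vec" assume v: "v \<in> carrier_vec n" "z n \<bullet> v = 0"
          show "\<kappa> * (v \<bullet> v) \<le> v \<bullet> ((- Y - Diag (dual_certificate n Y (z n))) *\<^sub>v v)"
            unfolding \<kappa>_def Y_def
            by (rule certificate_coercive[OF S z[rule_format] \<gamma>(1)[rule_format] _ _ v])
              (use Eb[OF that] in \<open>auto intro: less_imp_le\<close>)
        qed
        then show ?thesis using \<kappa>c unfolding Q_def Let_def Y_def[symmetric] by force
      qed
      with E show ?thesis by blast
    qed
    then obtain E where E: "\<And>n. E n \<in> sets (M n)" "\<And>n \<omega>. \<omega> \<in> E n \<Longrightarrow> Q n \<omega>"
      "\<And>n. max 2 N \<le> n \<Longrightarrow> f n \<le> measure (M n) (E n)" by metis
    have "(\<lambda>n. measure (M n) (E n)) \<longlonglongrightarrow> 1"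
    proof (rule real_tendsto_sandwich)
      show "f \<longlonglongrightarrow> 1"
        unfolding f_def s_def by (rule noise_probability_bound_tendsto[OF assms])
      show "(\<lambda>_. 1 :: real) \<longlonglongrightarrow> 1" by simp
      show "\<forall>\<^sub>F n in sequentially. f n \<le> measure (M n) (E n)"
        using E(3) unfolding eventually_sequentially by blast
      have "measure (M n) (E n) \<le> 1" for n
        using W by (intro prob_space.prob_le_1) (simp add: gaussian_noise_def)
      then show "\<forall>\<^sub>F n in sequentially. measure (M n) (E n) \<le> 1" by simp
    qed
    then have "whp M Q" unfolding whp_def using E(1,2) by (intro exI[of _ E]) auto
    then show "whp M (\<lambda>n \<omega>.
        let Y = outer (z n) + \<gamma> n \<cdot>\<^sub>m W n \<omega> in
          simple_sdp (diag_sdp Y) \<and>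
          primal_solution (diag_sdp Y) (outer (z n)) \<and>
          (\<forall>y. dual_solution (diag_sdp Y) y \<longrightarrow> eig (n - 1) (- Y - Diag y) > c * real n))"
      unfolding Q_def .
  qed
qed

end
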